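(* Let $n\ge 2$ be an integer, $k,c_b>0$, $\rho_0>0$, and let $\lambda_{1,0},\dots,\lambda_{n,0}$ be real numbers with $\lambda_{1,0}=\cdots=\lambda_{J,0}<\lambda_{J+1,0}\le\cdots\le\lambda_{n,0}$ for some integer $1\le J\le n$. Consider the system $$\lambda_i'=-\lambda_i^2+\frac{k}{n}(\rho-c_b)\ (i=1,\dots,n),\qquad \rho'=-\rho\lambda,\quad \lambda=\sum_{i=1}^n\lambda_i,\qquad \rho(0)=\rho_0,\ \lambda_i(0)=\lambda_{i,0},$$ suppose its maximal interval of existence is $[0,t_B)$ with $0<t_B<\infty$, let $u_i(t)=e^{\int_0^t\lambda_i(s)\,ds}$, and let $p,q$ be the real numbers with $\lim_{t\to t_B^-}u_1'(t)u_n(t)=-p$ and $\lim_{t\to t_B^-}u_1(t)u_n'(t)=q$. Suppose $p>q$ and set $\xi_1=\frac{-p}{p-q}$, $\xi_n=\frac{q}{p-q}$. Then there are functions $R_i$ on $[0,t_B)$ with $\lim_{t\to t_B^-}(t_B-t)R_i(t)=0$ ($1\le i\le n$), $R_i=R_1$ for $1\le i\le J$, such that $$\lambda_i(t)=\frac{\xi_1}{t_B-t}+R_i(t)\ (1\le i\le J),\qquad \lambda_i(t)=\frac{\xi_n}{t_B-t}+R_i(t)\ (J<i\le n),$$ and hence $\lambda(t)=\frac{\gamma}{t_B-t}+R(t)$ with $\gamma=\frac{-pJ+q(n-J)}{p-q}$ and $R=\sum_{i=1}^nR_i$. Moreover one of the following holds, where $\xi$ ranges over $\{\xi_1,\xi_n\}$: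 (1) $J=1$ and $\xi^2+\xi=0$; (2-a) $J=2$, $\lim_{t\to t_B^-}\int_0^tR(s)\,ds=\infty$, and $\xi^2+\xi=0$; (2-b) $J=2$, $n=4$, $\lim_{t\to t_B^-}e^{-\int_0^tR(s)\,ds}=R_0>0$, and $\xi^2+\xi-\frac{k\rho_0t_B^2R_0}{4}=0$; (3) $J\ge3$, $n>2J$, $\lim_{t\to t_B^-}e^{-\int_0^tR(s)\,ds}=R_0>0$, and $\xi^2+\xi-\frac{k\rho_0t_B^2R_0}{n}=0$. Furthermore: in case (1), $\lim_{t\to t_B^-}(t_B-t)\lambda_1(t)=-1$, $\lambda_i(t)=\mathcal O(|\ln(t_B-t)|)$ for $2\le i\le n$, and $\rho(t)=\mathcal O(\frac1{t_B-t})$ as $t\to t_B^-$; in case (2-a), $n\ge5$, $\lim_{t\to t_B^-}(t_B-t)\lambda_1(t)=-1$, and for $3\le i\le n$, $\lim_{t\to t_B^-}(t_B-t)\lambda_i(t)=0$ and $\lim_{t\to t_B^-}\int_0^t\lambda_i(s)\,ds=\infty$, and $\rho(t)=o(\frac1{(t_B-t)^2})$; in case (2-b), $A_0:=(\lambda_{1,0}-\lambda_{3,0})(\lambda_{1,0}-\lambda_{4,0})>k\rho_0$, $\lim_{t\to t_B^-}(t_B-t)\lambda_1(t)=-\frac12-\frac12\sqrt{\frac{A_0}{A_0-k\rho_0}}$, $\lim_{t\to t_B^-}(t_B-t)\lambda_i(t)=-\frac12+\frac12\sqrt{\frac{A_0}{A_0-k\rho_0}}$ for $i=3,4$, and $\rho(t)=\mathcal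 O(\frac1{(t_B-t)^2})$; in case (3), there is $C>1$ with $\lim_{t\to t_B^-}(t_B-t)\lambda_1(t)=-C$, $\lim_{t\to t_B^-}(t_B-t)\lambda_i(t)=C-1$ for $J+1\le i\le n$, and $\rho(t)=\mathcal O(\frac1{(t_B-t)^2})$ (all as $t\to t_B^-$).
   Context: Solutions are real-valued and continuously differentiable on $[0,t_B)$. It is known (and may be assumed) that the limits defining $p$ and $q$ exist with $0\le q\le p$. $f=\mathcal O(g)$ as $x\to x_0^-$ means $|f(x)|\le M|g(x)|$ for some $M,\delta>0$ and all $0<x_0-x<\delta$; $f=o(g)$ means for every $\varepsilon>0$ there is $\delta>0$ with $|f(x)|\le\varepsilon|g(x)|$ for $0<x_0-x<\delta$. *)

theory Defs
  imports "HOL-Analysis.Analysis" "HOL-Library.Landau_Symbols"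
begin

definition is_solution ::
  "nat \<Rightarrow> real \<Rightarrow> real \<Rightarrow> real \<Rightarrow> (nat \<Rightarrow> real) \<Rightarrow> real
     \<Rightarrow> (nat \<Rightarrow> real \<Rightarrow> real) \<Rightarrow> (real \<Rightarrow> real) \<Rightarrow> bool" where
  "is_solution n k cb rho0 lam0 T lam rho \<longleftrightarrow>
     (\<forall>i\<in>{1..n}. \<forall>t\<in>{0..<T}.
        (lam i has_real_derivative (- (lam i t)\<^sup>2 + k / real n * (rho t - cb)))
          (at t within {0..<T})) \<and>
     (\<forall>t\<in>{0..<T}.
        (rho has_real_derivative (- rho t * (\<Sum>i\<in>{1..n}. lam i t))) (at t within {0..<T})) \<and>
     rho 0 = rho0 \<and> (\<forall>i\<in>{1..n}. lam i 0 = lam0 i)"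

definition maximal_solution ::
  "nat \<Rightarrow> real \<Rightarrow> real \<Rightarrow> real \<Rightarrow> (nat \<Rightarrow> real) \<Rightarrow> real
     \<Rightarrow> (nat \<Rightarrow> real \<Rightarrow> real) \<Rightarrow> (real \<Rightarrow> real) \<Rightarrow> bool" where
  "maximal_solution n k cb rho0 lam0 tB lam rho \<longleftrightarrow>
     is_solution n k cb rho0 lam0 tB lam rho \<and>
     \<not> (\<exists>T > tB. \<exists>lam' rho'. is_solution n k cb rho0 lam0 T lam' rho')"

definition uu :: "(nat \<Rightarrow> real \<Rightarrow> real) \<Rightarrow> nat \<Rightarrow> real \<Rightarrow> real" where
  "uu lam i t = exp (integral {0..t} (lam i))"

end

theory Submission
  imports Defs "HOL-Probability.Discrete_Topology"
begin

text \<open>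
  All \<open>u\<^sub>i\<close> solve the same linear equation \<open>u'' = (k/n) (\<rho> - c\<^sub>b) u\<close>, so their Wronskians are
  constant, every \<open>u\<^sub>i\<close> is a combination of \<open>u\<^sub>1\<close> and \<open>u\<^sub>n\<close>, and \<open>\<rho> = \<rho>\<^sub>0 / \<Prod>u\<^sub>i\<close>. Since
  \<open>(u\<^sub>1 u\<^sub>n)' \<rightarrow> q - p < 0\<close>, the product \<open>u\<^sub>1 u\<^sub>n\<close> has a limit; a positive limit would keep the
  solution bounded and hence extendable, so the limit is 0 and \<open>u\<^sub>1 u\<^sub>n\<close> behaves like
  \<open>(p - q) (t\<^sub>B - t)\<close>. This gives the leading order of all \<open>\<lambda>\<^sub>i\<close>. In the time \<open>- ln (t\<^sub>B - t)\<close> the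
  function \<open>(t\<^sub>B - t) \<lambda>\<^sub>1\<close> converges, while the logarithmic derivative of \<open>(t\<^sub>B - t)\<^sup>2 \<rho>\<close> is bounded;
  a Tauberian argument then forces \<open>(k/n) (t\<^sub>B - t)\<^sup>2 \<rho> \<rightarrow> \<xi>\<^sup>2 + \<xi>\<close>. The limit of that logarithmic
  derivative is \<open>- 2 - \<gamma>\<close>, which must vanish if \<open>\<xi>\<^sup>2 + \<xi> > 0\<close> and be nonpositive if
  \<open>\<xi>\<^sup>2 + \<xi> = 0\<close>; this yields the list of cases. The finer claims for \<open>J \<le> 2\<close> use that \<open>u\<^sub>i\<close>,
  \<open>i > J\<close>, stays away from 0.
\<close>

section \<open>Local existence and extension of bounded solutions\<close>

text \<open>Banach's fixed point theorem for the integral operator on bounded continuous functions,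
  with contraction factor \<open>d * L\<close>.\<close>

lemma picard_global:
  fixes F :: "'a::banach \<Rightarrow> 'a"
  assumes L: "L-lipschitz_on UNIV F" and d: "0 < d" "d * L < 1"
  obtains x where "x 0 = x0"
    "\<And>t. t \<in> {0..d} \<Longrightarrow> (x has_vector_derivative F (x t)) (at t within {0..d})"
proof -
  \<comment> \<open>Elements of \<open>bcontfun\<close> live on all of \<open>real\<close>, so time
    is clamped to \<open>{0..d}\<close>: the iterates are constant outside this interval, hence
    bounded.\<close>
  define c where "c = (\<lambda>t::real. max 0 (min d t))"
  have c: "0 \<le> c t" "c t \<le> d" for t using d by (auto simp: c_def)
  have c_id: "c t = t" if "t \<in> {0..d}" for t using that by (auto simp: c_def)
  have cont_c: "continuous_on UNIV c" unfolding c_def by (intro continuous_intros)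
  have cF: "continuous_on S (\<lambda>s. F (apply_bcontfun \<phi> s))" for S and \<phi> :: "real \<Rightarrow>\<^sub>C 'a"
    by (rule continuous_on_compose2[OF lipschitz_on_continuous_on[OF L]]) auto
  define G where "G = (\<lambda>\<phi> :: real \<Rightarrow>\<^sub>C 'a. \<lambda>t. integral {0..t} (\<lambda>s. F (apply_bcontfun \<phi> s)))"
  have G_deriv: "(G \<phi> has_vector_derivative F (apply_bcontfun \<phi> t)) (at t within {0..d})"
    if "t \<in> {0..d}" for \<phi> t
    unfolding G_def by (rule integral_has_vector_derivative[OF cF that])
  have G_cont: "continuous_on {0..d} (G \<phi>)" for \<phi>
    unfolding continuous_on_eq_continuous_within
    using G_deriv has_vector_derivative_continuous by blast
  have "(\<lambda>t. x0 + G \<phi> (c t)) \<in> bcontfun" for \<phi>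
  proof -
    have "continuous_on UNIV (\<lambda>t. G \<phi> (c t))"
      by (rule continuous_on_compose2[OF G_cont cont_c]) (use c in auto)
    moreover have "bounded (range (\<lambda>t. x0 + G \<phi> (c t)))"
    proof (rule bounded_subset)
      show "bounded ((\<lambda>t. x0 + G \<phi> t) ` {0..d})"
        by (intro compact_imp_bounded compact_continuous_image continuous_intros G_cont) simp
    qed (use c in auto)
    ultimately show ?thesis by (auto simp: bcontfun_def intro!: continuous_intros)
  qed
  then have app_T: "apply_bcontfun (Bcontfun (\<lambda>t. x0 + G \<phi> (c t))) t = x0 + G \<phi> (c t)" for \<phi> t
    by (simp add: Bcontfun_inverse)
  have L0: "0 \<le> L" using L by (rule lipschitz_on_nonneg)
  have "\<exists>!\<phi>. Bcontfun (\<lambda>t. x0 + G \<phi> (c t)) = \<phi>"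
  proof (rule banach_fix_type[of "d * L"], safe)
    fix \<phi> \<psi> :: "real \<Rightarrow>\<^sub>C 'a"
    show "dist (Bcontfun (\<lambda>t. x0 + G \<phi> (c t))) (Bcontfun (\<lambda>t. x0 + G \<psi> (c t)))
          \<le> d * L * dist \<phi> \<psi>"
    proof (rule dist_bound)
      fix t
      have "G \<phi> (c t) - G \<psi> (c t) =
            integral {0..c t} (\<lambda>s. F (apply_bcontfun \<phi> s) - F (apply_bcontfun \<psi> s))"
        unfolding G_def
        by (intro integral_diff[symmetric] integrable_continuous_interval cF)
      also have "norm \<dots> \<le> L * dist \<phi> \<psi> * (c t - 0)"
      proof (rule integral_bound)
        fix s
        have "norm (F (apply_bcontfun \<phi> s) - F (apply_bcontfun \<psi> s))
              \<le> L * dist (apply_bcontfun \<phi> s) (apply_bcontfun \<psi> s)"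
          using lipschitz_onD[OF L] by (simp add: dist_norm)
        also have "\<dots> \<le> L * dist \<phi> \<psi>"
          using L0 dist_bounded by (intro mult_left_mono) auto
        finally show "norm (F (apply_bcontfun \<phi> s) - F (apply_bcontfun \<psi> s)) \<le> L * dist \<phi> \<psi>" .
      qed (use c cF in \<open>auto intro!: continuous_intros\<close>)
      also have "\<dots> \<le> L * dist \<phi> \<psi> * d"
        using c L0 by (intro mult_left_mono) auto
      finally show "dist (apply_bcontfun (Bcontfun (\<lambda>t. x0 + G \<phi> (c t))) t)
          (apply_bcontfun (Bcontfun (\<lambda>t. x0 + G \<psi> (c t))) t) \<le> d * L * dist \<phi> \<psi>"
        by (simp add: app_T dist_norm mult_ac)
    qed
  qed (use d L0 in auto)
  then obtain \<phi> where "Bcontfun (\<lambda>t. x0 + G \<phi> (c t)) = \<phi>" by blast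
  then have \<phi>: "apply_bcontfun \<phi> t = x0 + G \<phi> (c t)" for t by (metis app_T)
  show ?thesis
  proof
    show "apply_bcontfun \<phi> 0 = x0" using d by (simp add: \<phi> c_id) (simp add: G_def)
    fix t assume t: "t \<in> {0..d}"
    have "((\<lambda>t. x0 + G \<phi> t) has_vector_derivative F (apply_bcontfun \<phi> t)) (at t within {0..d})"
      using G_deriv[OF t, of \<phi>] by (auto intro!: derivative_eq_intros)
    then show "(apply_bcontfun \<phi> has_vector_derivative F (apply_bcontfun \<phi> t)) (at t within {0..d})"
      by (rule has_vector_derivative_transform[OF t, rotated]) (simp add: \<phi> c_id)
  qed
qed


text \<open>Completeness makes \<open>picard_global\<close> applicable to the state space of bounded
  functions on \<open>nat discrete\<close>.\<close>

instance bcontfun :: (metric_space, banach) banach ..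

text \<open>Bounded linear maps commute with differentiation, so a differentiable curve of sequences
  has differentiable coordinates.\<close>

lemma bounded_linear_apply_bcontfun:
  "bounded_linear (\<lambda>x :: 'a::topological_space \<Rightarrow>\<^sub>C 'b::real_normed_vector. apply_bcontfun x i)"
  by (rule bounded_linear_intro[of _ 1]) (auto simp: norm_bounded)

text \<open>All preimages are open in a discrete space; membership in \<open>bcontfun\<close> thus
  reduces to boundedness.\<close>

lemma continuous_on_discrete_UNIV: "continuous_on UNIV (h :: 'a discrete \<Rightarrow> 'b::topological_space)"
  by (simp add: continuous_on_open_vimage open_discrete)

lemma abs_mult_diff_le:
  fixes a a' b b' N M e :: real
  assumes "\<bar>a\<bar> \<le> N" "\<bar>b'\<bar> \<le> M" "\<bar>a - a'\<bar> \<le> d" "\<bar>b - b'\<bar> \<le> e"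
  shows "\<bar>a * b - a' * b'\<bar> \<le> N * e + M * d"
proof -
  have "a * b - a' * b' = a * (b - b') + b' * (a - a')" by (simp add: algebra_simps)
  also have "\<bar>\<dots>\<bar> \<le> \<bar>a\<bar> * \<bar>b - b'\<bar> + \<bar>b'\<bar> * \<bar>a - a'\<bar>"
    by (metis abs_mult abs_triangle_ineq)
  also have "\<dots> \<le> N * e + M * d"
    using assms by (intro add_mono mult_mono) auto
  finally show ?thesis .
qed

text \<open>Truncating the unknowns makes the right-hand side globally Lipschitz; on a time interval
  whose length depends only on the size of the data the truncation stays inactive. The state
  space consists of the bounded sequences (bounded functions on a discrete space), because the dimension is not fixed by a type.\<close>

lemma local_solution_uniform:
  fixes n :: nat and k cb M :: real
  assumes M: "M \<ge> 0"
  obtains d where "d > 0"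
    "\<And>r0 l0. \<lbrakk>\<bar>r0\<bar> \<le> M; \<And>i. i \<in> {1..n} \<Longrightarrow> \<bar>l0 i\<bar> \<le> M\<rbrakk> \<Longrightarrow>
       \<exists>lam rho. is_solution n k cb r0 l0 d lam rho"
proof -
  \<comment> \<open>The truncation level exceeds the size of the data by 1; this slack is the
    distance a solution may travel before the truncation is felt.\<close>
  define N where "N = M + 1"
  define cl where "cl = (\<lambda>a::real. max (-N) (min N a))"
  have N: "N > 0" using M by (simp add: N_def)
  have cl: "\<bar>cl a\<bar> \<le> N" for a using N by (auto simp: cl_def)
  have cl_lip: "\<bar>cl a - cl b\<bar> \<le> \<bar>a - b\<bar>" for a b by (auto simp: cl_def)
  define ap where "ap = (\<lambda>(x :: nat discrete \<Rightarrow>\<^sub>C real) i. apply_bcontfun x (discrete i))"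
  define S where "S = (\<lambda>x :: nat discrete \<Rightarrow>\<^sub>C real. \<Sum>i\<in>{1..n}. cl (ap x i))"
  have S: "\<bar>S x\<bar> \<le> real n * N" for x
  proof -
    have "\<bar>S x\<bar> \<le> (\<Sum>i\<in>{1..n}. \<bar>cl (ap x i)\<bar>)" unfolding S_def by (rule sum_abs)
    also have "\<dots> \<le> (\<Sum>i\<in>{1..n}. N)" by (intro sum_mono cl)
    finally show ?thesis by simp
  qed
  have app: "\<bar>ap x i - ap y i\<bar> \<le> dist x y" for x y :: "nat discrete \<Rightarrow>\<^sub>C real" and i
    using dist_bounded[of x "discrete i" y] by (simp add: dist_real_def ap_def)
  have cl_app: "\<bar>cl (ap x i) - cl (ap y i)\<bar> \<le> dist x y"
    for x y :: "nat discrete \<Rightarrow>\<^sub>C real" and i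
    using cl_lip app by (meson order_trans)
  have S_lip: "\<bar>S x - S y\<bar> \<le> real n * dist x y" for x y
  proof -
    have "\<bar>S x - S y\<bar> \<le> (\<Sum>i\<in>{1..n}. \<bar>cl (ap x i) - cl (ap y i)\<bar>)"
      unfolding S_def sum_subtractf[symmetric] by (rule sum_abs)
    also have "\<dots> \<le> (\<Sum>i\<in>{1..n}. dist x y)" by (intro sum_mono cl_app)
    finally show ?thesis by simp
  qed
  \<comment> \<open>Coordinate 0 carries the density, coordinates 1 to \<open>n\<close> carry the
    \<open>lam i\<close>, and all later coordinates stand still.\<close>
  define f where "f = (\<lambda>(x :: nat discrete \<Rightarrow>\<^sub>C real) i::nat.
     if i = 0 then - (cl (ap x 0) * S x)
     else if i \<le> n then - (cl (ap x i) * cl (ap x i))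
            + k / real n * (cl (ap x 0) - cb) else 0)"
  define B where "B = N * (real n * N) + N * N + \<bar>k / real n\<bar> * (N + \<bar>cb\<bar>)"
  have f_bound: "\<bar>f x i\<bar> \<le> B" for x i
  proof -
    have 1: "\<bar>cl (ap x 0) * S x\<bar> \<le> N * (real n * N)"
      using N unfolding abs_mult by (intro mult_mono cl S) auto
    have 2: "\<bar>cl (ap x i) * cl (ap x i)\<bar> \<le> N * N"
      using N unfolding abs_mult by (intro mult_mono cl) auto
    have 3: "\<bar>k / real n * (cl (ap x 0) - cb)\<bar> \<le> \<bar>k / real n\<bar> * (N + \<bar>cb\<bar>)"
      using cl[of "ap x 0"] unfolding abs_mult by (intro mult_left_mono) auto
    have "0 \<le> N * (real n * N)" "0 \<le> N * N" "0 \<le> \<bar>k / real n\<bar> * (N + \<bar>cb\<bar>)" using N by auto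
    then show ?thesis using 1 2 3 unfolding f_def B_def by (smt (verit))
  qed
  define F where "F = (\<lambda>x. Bcontfun (\<lambda>j. f x (of_discrete j)))"
  have "(\<lambda>j. f x (of_discrete j)) \<in> bcontfun" for x
    using f_bound by (intro bcontfun_normI[of _ B] continuous_on_discrete_UNIV) auto
  then have app_F: "apply_bcontfun (F x) j = f x (of_discrete j)" for x j
    by (simp add: Bcontfun_inverse F_def)
  define L where "L = 2 * real n * N + 2 * N + \<bar>k / real n\<bar>"
  have L0: "L \<ge> 0" using N by (simp add: L_def)
  have B0: "B \<ge> 0" using f_bound[of 0 0] by linarith
  have F_lip: "L-lipschitz_on UNIV F"
  proof (rule lipschitz_onI)
    fix x y :: "nat discrete \<Rightarrow>\<^sub>C real"
    show "dist (F x) (F y) \<le> L * dist x y"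
    proof (rule dist_bound)
      fix j :: "nat discrete"
      define i where "i = of_discrete j"
      have 1: "\<bar>cl (ap x 0) * S x - cl (ap y 0) * S y\<bar>
          \<le> N * (real n * dist x y) + (real n * N) * dist x y"
        by (intro abs_mult_diff_le cl S S_lip cl_app)
      have 2: "\<bar>cl (ap x i) * cl (ap x i)
            - cl (ap y i) * cl (ap y i)\<bar> \<le> N * dist x y + N * dist x y"
        by (intro abs_mult_diff_le cl cl_app)
      have 3: "\<bar>k / real n * (cl (ap x 0) - cb) - k / real n * (cl (ap y 0) - cb)\<bar>
           \<le> \<bar>k / real n\<bar> * dist x y"
        unfolding right_diff_distrib[symmetric] abs_mult
        using cl_app[of x 0 y] by (intro mult_left_mono) auto
      have eq: "L * dist x y = (N * (real n * dist x y) + (real n * N) * dist x y)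
          + (N * dist x y + N * dist x y) + \<bar>k / real n\<bar> * dist x y"
        by (simp add: L_def algebra_simps)
      have "0 \<le> N * (real n * dist x y)" "0 \<le> (real n * N) * dist x y" "0 \<le> N * dist x y"
          "0 \<le> \<bar>k / real n\<bar> * dist x y" using N by auto
      then show "dist (apply_bcontfun (F x) j) (apply_bcontfun (F y) j)
          \<le> L * dist x y"
        using 1 2 3 unfolding eq app_F dist_real_def i_def[symmetric] unfolding f_def by (smt (verit))
    qed
  qed (rule L0)
  \<comment> \<open>\<open>d * L < 1\<close> gives the contraction. \<open>B * d \<le> 1\<close>
    keeps a solution, whose coordinates move with speed at most \<open>B\<close>, within distance 1
    of its data, hence inside the region where \<open>cl\<close> is the identity.\<close>
  define d where "d = 1 / (L + B + 1)"
  have d: "d > 0" "d * L < 1" "B * d \<le> 1" using L0 B0 by (auto simp: d_def field_simps)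
  show ?thesis
  proof
    show "d > 0" by fact
    fix r0 :: real and l0 :: "nat \<Rightarrow> real"
    assume r0: "\<bar>r0\<bar> \<le> M" and l0: "\<And>i. i \<in> {1..n} \<Longrightarrow> \<bar>l0 i\<bar> \<le> M"
    define z where "z = (\<lambda>i. if i = 0 then r0 else if i \<le> n then l0 i else 0)"
    have z_le: "\<bar>z i\<bar> \<le> M" for i using r0 l0[of i] M by (auto simp: z_def)
    then have "(\<lambda>j. z (of_discrete j)) \<in> bcontfun"
      by (intro bcontfun_normI[of _ M] continuous_on_discrete_UNIV) auto
    then have app_z: "ap (Bcontfun (\<lambda>j. z (of_discrete j))) i = z i" for i
      by (simp add: Bcontfun_inverse ap_def discrete_inverse)
    obtain x where x0: "x 0 = Bcontfun (\<lambda>j. z (of_discrete j))" and x: "\<And>t. t \<in> {0..d} \<Longrightarrow>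
        (x has_vector_derivative F (x t)) (at t within {0..d})"
      using picard_global[OF F_lip d(1,2)] by blast
    define y where "y = (\<lambda>i t. ap (x t) i)"
    have y: "(y i has_real_derivative f (x t) i) (at t within {0..d})" if "t \<in> {0..d}" for t i
      using bounded_linear.has_vector_derivative[OF bounded_linear_apply_bcontfun[of "discrete i"] x[OF that]]
      by (simp add: has_real_derivative_iff_has_vector_derivative app_F y_def ap_def discrete_inverse)
    have y0: "y i 0 = z i" for i by (simp add: y_def x0 app_z)
    have y_le: "\<bar>y i t\<bar> \<le> N" if t: "t \<in> {0..d}" for i t
    proof -
      have "norm (y i t - y i 0) \<le> B * norm (t - 0)"
        by (rule field_differentiable_bound[of "{0..d}"])
           (use y f_bound t d in auto)
      also have "\<dots> \<le> B * d" using t B0 by (intro mult_left_mono) auto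
      finally show ?thesis using d z_le[of i] y0[of i] by (simp add: N_def)
    qed
    have cl_y: "cl (y i t) = y i t" if "t \<in> {0..d}" for i t
      using y_le[OF that, of i] by (auto simp: cl_def)
    have ivl_sub: "{0..<d} \<subseteq> {0..d}" by auto
    have "is_solution n k cb r0 l0 d y (y 0)"
      unfolding is_solution_def
    proof (intro conjI ballI)
      fix i t assume i: "i \<in> {1..n}" and t: "t \<in> {0..<d}"
      then have t': "t \<in> {0..d}" by auto
      have "f (x t) i = - (y i t)\<^sup>2 + k / real n * (y 0 t - cb)"
        using i cl_y[OF t'] by (simp add: f_def y_def power2_eq_square)
      then show "(y i has_real_derivative - (y i t)\<^sup>2 + k / real n * (y 0 t - cb)) (at t within {0..<d})"
        using DERIV_subset[OF y[OF t', of i] ivl_sub] by simp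
    next
      fix t assume t: "t \<in> {0..<d}"
      then have t': "t \<in> {0..d}" by auto
      have "f (x t) 0 = - y 0 t * (\<Sum>i\<in>{1..n}. y i t)"
        using cl_y[OF t'] by (simp add: f_def S_def y_def)
      then show "(y 0 has_real_derivative - y 0 t * (\<Sum>i\<in>{1..n}. y i t)) (at t within {0..<d})"
        using DERIV_subset[OF y[OF t', of 0] ivl_sub] by simp
    qed (auto simp: y0 z_def)
    then show "\<exists>lam rho. is_solution n k cb r0 l0 d lam rho" by blast
  qed
qed

text \<open>At the junction \<open>t0\<close> the left and right derivatives agree by
  \<open>F t0 = G 0\<close>. For an autonomous equation this is automatic once the values
  agree.\<close>

lemma glue_real_derivative:
  fixes f g F G :: "real \<Rightarrow> real"
  assumes f: "\<And>t. t \<in> {0..<T} \<Longrightarrow> (f has_real_derivative F t) (at t within {0..<T})"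
    and g: "\<And>t. t \<in> {0..<d} \<Longrightarrow> (g has_real_derivative G t) (at t within {0..<d})"
    and t0: "0 < t0" "t0 < T" and d: "0 < d" and eq: "f t0 = g 0" "F t0 = G 0"
    and t: "t \<in> {0..<t0 + d}"
  shows "((\<lambda>t. if t \<in> {0..t0} then f t else g (t - t0)) has_real_derivative
          (if t \<in> {0..t0} then F t else G (t - t0))) (at t within {0..<t0 + d})"
proof -
  have cl: "closure {0..t0} \<inter> closure {t0..<t0 + d} = {t0}" using t0 d by auto
  have sub: "{0..t0} \<union> {t0} \<subseteq> {0..<T}" using t0 by auto
  have g': "((\<lambda>t. g (t - t0)) has_real_derivative G (t - t0)) (at t within {t0..<t0 + d})"
    if "t \<in> {t0..<t0 + d}" for t
  proof -
    have "(\<lambda>t. t - t0) ` {t0..<t0 + d} = {0..<d}"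
      using image_add_atLeastLessThan'[of "- t0" t0 "t0 + d"] by simp
    then show ?thesis
      using that DERIV_image_chain[of g "G (t - t0)" "\<lambda>t. t - t0" t "{t0..<t0 + d}" 1] g[of "t - t0"]
        DERIV_diff[OF DERIV_ident DERIV_const, of t0 t "{t0..<t0 + d}"]
      by (auto simp: o_def)
  qed
  show ?thesis
    unfolding has_real_derivative_iff_has_vector_derivative
  proof (rule has_vector_derivative_If_within_closures[where S = "{0..t0}" and T = "{t0..<t0 + d}"];
      (unfold cl)?)
    assume "t \<in> {0..t0} \<union> {t0}"
    then show "(f has_vector_derivative F t) (at t within {0..t0} \<union> {t0})"
      using DERIV_subset[OF f[of t] sub] t0
      by (auto simp: has_real_derivative_iff_has_vector_derivative)
  next
    assume "t \<in> {t0..<t0 + d} \<union> {t0}"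
    then show "((\<lambda>t. g (t - t0)) has_vector_derivative G (t - t0)) (at t within {t0..<t0 + d} \<union> {t0})"
      using g'[of t] d
      by (auto simp: has_real_derivative_iff_has_vector_derivative insert_absorb)
  next
    assume "t \<in> closure {0..t0}" "t \<in> closure {t0..<t0 + d}"
    then have "t = t0" using cl by blast
    then show "f t = g (t - t0)" "F t = G (t - t0)" using eq by auto
  qed (use t t0 d in auto)
qed

text \<open>The existence time \<open>d\<close> depends only on the bound \<open>M\<close>, so
  restarting the equation less than \<open>d\<close> before \<open>T\<close> carries the solution
  past \<open>T\<close>.\<close>

lemma bounded_solution_extends:
  assumes sol: "is_solution n k cb rho0 lam0 T lam rho" and T: "0 < T"
    and lam: "\<And>i. i \<in> {1..n} \<Longrightarrow> \<forall>\<^sub>F t in at_left T. \<bar>lam i t\<bar> \<le> M"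
    and rho: "\<forall>\<^sub>F t in at_left T. \<bar>rho t\<bar> \<le> M"
  shows "\<exists>T' > T. \<exists>lam' rho'. is_solution n k cb rho0 lam0 T' lam' rho'"
proof -
  have "\<forall>\<^sub>F t in at_left T. \<bar>rho t\<bar> \<le> M \<and> (\<forall>i\<in>{1..n}. \<bar>lam i t\<bar> \<le> M)"
    using rho lam by (simp add: eventually_conj_iff eventually_ball_finite_distrib)
  then obtain b where b: "b < T"
      "\<And>t. b < t \<Longrightarrow> t < T \<Longrightarrow> \<bar>rho t\<bar> \<le> M \<and> (\<forall>i\<in>{1..n}. \<bar>lam i t\<bar> \<le> M)"
    unfolding eventually_at_left[OF T] by metis
  have "M \<ge> 0" using dense[OF b(1)] b(2) abs_ge_zero order_trans by metis
  then obtain d where d: "d > 0" and ex: "\<And>r0 l0. \<lbrakk>\<bar>r0\<bar> \<le> M; \<And>i. i \<in> {1..n} \<Longrightarrow> \<bar>l0 i\<bar> \<le> M\<rbrakk> \<Longrightarrow>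
       \<exists>l r. is_solution n k cb r0 l0 d l r"
    using local_solution_uniform by metis
  \<comment> \<open>The three entries put \<open>t0\<close> beyond \<open>b\<close>, where the
    bounds hold, to the right of 0, and within \<open>d / 2\<close> of \<open>T\<close>.\<close>
  define t0 where "t0 = max ((b + T) / 2) (max (T / 2) (T - d / 2))"
  have t0: "b < t0" "0 < t0" "t0 < T" "T < t0 + d"
    using b(1) T d by (auto simp: t0_def less_max_iff_disj)
  obtain l r where lr: "is_solution n k cb (rho t0) (\<lambda>i. lam i t0) d l r"
    using ex[of "rho t0" "\<lambda>i. lam i t0"] b(2)[OF t0(1,3)] by auto
  define lam' where "lam' = (\<lambda>i t. if t \<in> {0..t0} then lam i t else l i (t - t0))"
  define rho' where "rho' = (\<lambda>t. if t \<in> {0..t0} then rho t else r (t - t0))"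
  have "is_solution n k cb rho0 lam0 (t0 + d) lam' rho'"
    unfolding is_solution_def
  proof (intro conjI ballI)
    fix i t assume i: "i \<in> {1..n}" and t: "t \<in> {0..<t0 + d}"
    have "(lam' i has_real_derivative (if t \<in> {0..t0} then - (lam i t)\<^sup>2 + k / real n * (rho t - cb)
        else - (l i (t - t0))\<^sup>2 + k / real n * (r (t - t0) - cb))) (at t within {0..<t0 + d})"
      unfolding lam'_def
      by (rule glue_real_derivative[where T = T and G = "\<lambda>t. - (l i t)\<^sup>2 + k / real n * (r t - cb)"])
         (use i t sol lr t0 d in \<open>auto simp: is_solution_def\<close>)
    then show "(lam' i has_real_derivative - (lam' i t)\<^sup>2 + k / real n * (rho' t - cb))
        (at t within {0..<t0 + d})"
      by (cases "t \<in> {0..t0}") (simp_all only: lam'_def rho'_def if_True if_False)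
  next
    fix t assume t: "t \<in> {0..<t0 + d}"
    have "(rho' has_real_derivative (if t \<in> {0..t0} then - rho t * (\<Sum>i\<in>{1..n}. lam i t)
        else - r (t - t0) * (\<Sum>i\<in>{1..n}. l i (t - t0)))) (at t within {0..<t0 + d})"
      unfolding rho'_def
      by (rule glue_real_derivative[where T = T and G = "\<lambda>t. - r t * (\<Sum>i\<in>{1..n}. l i t)"])
         (use t sol lr t0 d in \<open>auto simp: is_solution_def\<close>)
    then show "(rho' has_real_derivative - rho' t * (\<Sum>i\<in>{1..n}. lam' i t))
        (at t within {0..<t0 + d})"
      by (cases "t \<in> {0..t0}") (simp_all only: lam'_def rho'_def if_True if_False)
  qed (use sol t0 in \<open>auto simp: is_solution_def lam'_def rho'_def\<close>)
  then show ?thesis using t0(4) by blast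
qed

section \<open>Asymptotics of real functions\<close>

text \<open>Together with the next fact this is the change of time \<open>x = - ln (T - t)\<close>,
  which turns limits at \<open>T\<close> into limits at infinity.\<close>

lemma filterlim_minus_exp_at_left:
  fixes T :: real
  shows "filterlim (\<lambda>x. T - exp (- x)) (at_left T) at_top"
proof (rule tendsto_imp_filterlim_at_left)
  have "((\<lambda>x. exp (- x)) \<longlongrightarrow> (0::real)) at_top"
    by (rule filterlim_compose[OF exp_at_bot filterlim_uminus_at_bot_at_top])
  then show "((\<lambda>x. T - exp (- x)) \<longlongrightarrow> T) at_top"
    using tendsto_diff[OF tendsto_const[of T]] by force
qed auto

lemma filterlim_minus_ln_at_left:
  fixes T :: real
  shows "filterlim (\<lambda>t. - ln (T - t)) at_top (at_left T)"
proof -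
  have "filterlim (\<lambda>t. T - t) (at_right 0) (at_left T)"
  proof (rule tendsto_imp_filterlim_at_right)
    show "((\<lambda>t. T - t) \<longlongrightarrow> 0) (at_left T)"
      by (rule tendsto_eq_intros refl | simp)+
  qed (auto simp: eventually_at_filter)
  then have "filterlim (\<lambda>t. ln (T - t)) at_bot (at_left T)"
    by (rule filterlim_compose[OF ln_at_0])
  then show ?thesis by (simp add: filterlim_uminus_at_top)
qed

lemma filterlim_add_const_at_top: "filterlim (\<lambda>x::real. x + c) at_top at_top"
  using filterlim_tendsto_add_at_top[OF tendsto_const filterlim_ident, of c]
  by (simp add: add.commute)

text \<open>A Tauberian statement: \<open>s\<close> cannot stay away from \<open>- e0\<close> over a window of fixed length, since
  \<open>m\<close> would move by a fixed amount; and within a window \<open>s\<close> changes only by a bounded factor.\<close>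

lemma tendsto_if_primitive_converges:
  fixes m e s l :: "real \<Rightarrow> real"
  assumes m: "(m \<longlongrightarrow> m0) at_top" and e: "(e \<longlongrightarrow> e0) at_top"
    and dm: "\<forall>\<^sub>F x in at_top. (m has_real_derivative e x + s x) (at x)"
    and pos: "\<forall>\<^sub>F x in at_top. 0 < s x"
    and dln: "\<forall>\<^sub>F x in at_top. ((\<lambda>x. ln (s x)) has_real_derivative l x) (at x)"
    and l: "\<forall>\<^sub>F x in at_top. \<bar>l x\<bar> \<le> K"
  shows "(s \<longlongrightarrow> - e0) at_top"
proof -
  have window: "\<forall>\<^sub>F x in at_top. exp (- K * h) * (- e0 - h) \<le> s x \<and> s x \<le> exp (K * h) * (- e0 + h)"
    if h: "h > 0" for h
  proof -
    have "((\<lambda>x. m (x + h)) \<longlongrightarrow> m0) at_top"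
      by (rule filterlim_compose[OF m filterlim_add_const_at_top])
    then have "((\<lambda>x. m (x + h) - m x) \<longlongrightarrow> m0 - m0) at_top" by (intro tendsto_diff m)
    \<comment> \<open>The mean value theorem divides this increment by the window length
      \<open>h\<close>. What remains is \<open>h / 2\<close>, which together with the error
      \<open>h / 2\<close> of \<open>e\<close> puts \<open>s z\<close> within \<open>h\<close> of
      \<open>- e0\<close> at some \<open>z\<close> in the window.\<close>
    then have "\<forall>\<^sub>F x in at_top. dist (m (x + h) - m x) (m0 - m0) < h * h / 2"
      by (rule tendstoD) (use h in auto)
    moreover have "\<forall>\<^sub>F x in at_top. dist (e x) e0 < h / 2"
      using e by (rule tendstoD) (use h in auto)
    ultimately have "\<forall>\<^sub>F x in at_top. dist (m (x + h) - m x) (m0 - m0) < h * h / 2 \<and>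
        dist (e x) e0 < h / 2 \<and> (m has_real_derivative e x + s x) (at x) \<and> 0 < s x \<and>
        ((\<lambda>x. ln (s x)) has_real_derivative l x) (at x) \<and> \<bar>l x\<bar> \<le> K"
      using dm pos dln l by (intro eventually_conj)
    then obtain X where X: "\<And>x. x \<ge> X \<Longrightarrow> \<bar>m (x + h) - m x\<bar> < h * h / 2 \<and>
        \<bar>e x - e0\<bar> < h / 2 \<and> (m has_real_derivative e x + s x) (at x) \<and> 0 < s x \<and>
        ((\<lambda>x. ln (s x)) has_real_derivative l x) (at x) \<and> \<bar>l x\<bar> \<le> K"
      unfolding eventually_at_top_linorder by (auto simp: dist_real_def)
    show ?thesis
      unfolding eventually_at_top_linorder
    proof (intro exI[of _ X] allI impI)
      fix x assume x: "X \<le> x"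
      obtain z where z: "x < z" "z < x + h" "m (x + h) - m x = (x + h - x) * (e z + s z)"
        using MVT2[of x "x + h" m "\<lambda>x. e x + s x"] X x h by force
      have K: "K \<ge> 0" using X[OF x] by linarith
      have "\<bar>h * (e z + s z)\<bar> < h * (h / 2)" using z X[OF x] by simp
      then have "\<bar>e z + s z\<bar> < h / 2" using h by (simp add: abs_mult)
      moreover have "\<bar>e z - e0\<bar> < h / 2" using X[of z] x z by simp
      ultimately have sz: "- e0 - h \<le> s z" "s z \<le> - e0 + h" by linarith+
      \<comment> \<open>The bound on the logarithmic derivative transports the estimate from
        \<open>z\<close> back to \<open>x\<close> at the cost of a factor
        \<open>exp (K * h)\<close>.\<close>
      have "norm (ln (s z) - ln (s x)) \<le> K * norm (z - x)"
        by (rule field_differentiable_bound[of "{x..z}" "\<lambda>x. ln (s x)" l])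
           (use X x z in \<open>auto intro: has_field_derivative_at_within\<close>)
      also have "\<dots> \<le> K * h" using z K by (intro mult_left_mono) auto
      finally have ln: "ln (s x) \<le> ln (s z) + K * h" "ln (s z) - K * h \<le> ln (s x)" by auto
      have px: "0 < s x" "0 < s z" using X[of x] X[of z] x z by auto
      have "exp (ln (s x)) \<le> exp (ln (s z) + K * h)" "exp (ln (s z) - K * h) \<le> exp (ln (s x))"
        using ln by auto
      then have "s x \<le> exp (K * h) * s z" "exp (- K * h) * s z \<le> s x"
        using px by (simp_all add: exp_add exp_diff exp_minus divide_inverse mult.commute)
      moreover have "exp (K * h) * s z \<le> exp (K * h) * (- e0 + h)"
        "exp (- K * h) * (- e0 - h) \<le> exp (- K * h) * s z"
        using sz by (auto intro: mult_left_mono)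
      ultimately show "exp (- K * h) * (- e0 - h) \<le> s x \<and> s x \<le> exp (K * h) * (- e0 + h)"
        by linarith
    qed
  qed
  \<comment> \<open>Both window bounds tend to \<open>- e0\<close> as \<open>h\<close> tends to 0,
    so any strict inequality around \<open>- e0\<close> is met by some positive
    \<open>h\<close>.\<close>
  have ex_pos: "\<exists>h>0. P h" if "\<forall>\<^sub>F h in at_right (0::real). P h" for P
    using that eventually_at_right_less[of "0::real"] eventually_happens'[of "at_right (0::real)"]
    by (metis (mono_tags, lifting) eventually_conj trivial_limit_at_right_real)
  show ?thesis
  proof (rule order_tendstoI)
    fix a assume a: "a < - e0"
    have "((\<lambda>h. exp (- K * h) * (- e0 - h)) \<longlongrightarrow> exp (- K * 0) * (- e0 - 0)) (at_right 0)"
      by (intro tendsto_intros)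
    then have "\<forall>\<^sub>F h in at_right 0. a < exp (- K * h) * (- e0 - h)"
      by (rule order_tendstoD) (use a in simp)
    then obtain h where h: "h > 0" "a < exp (- K * h) * (- e0 - h)" using ex_pos by blast
    show "\<forall>\<^sub>F x in at_top. a < s x"
      using window[OF h(1)] by eventually_elim (use h in linarith)
  next
    fix a assume a: "- e0 < a"
    have "((\<lambda>h. exp (K * h) * (- e0 + h)) \<longlongrightarrow> exp (K * 0) * (- e0 + 0)) (at_right 0)"
      by (intro tendsto_intros)
    then have "\<forall>\<^sub>F h in at_right 0. exp (K * h) * (- e0 + h) < a"
      by (rule order_tendstoD) (use a in simp)
    then obtain h where h: "h > 0" "exp (K * h) * (- e0 + h) < a" using ex_pos by blast
    show "\<forall>\<^sub>F x in at_top. s x < a"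
      using window[OF h(1)] by eventually_elim (use h in linarith)
  qed
qed

text \<open>Over a window of length 1 the increment of \<open>f\<close> tends to 0, but by the mean
  value theorem it is a value of \<open>f'\<close>, which is close to \<open>d\<close>.\<close>

lemma derivative_limit_zero_if_converges:
  fixes f f' :: "real \<Rightarrow> real"
  assumes f: "(f \<longlongrightarrow> c) at_top"
    and df: "\<forall>\<^sub>F x in at_top. (f has_real_derivative f' x) (at x)"
    and f': "(f' \<longlongrightarrow> d) at_top"
  shows "d = 0"
proof (rule ccontr)
  assume d: "d \<noteq> 0"
  have "((\<lambda>x. f (x + 1) - f x) \<longlongrightarrow> c - c) at_top"
    by (intro tendsto_diff f filterlim_compose[OF f filterlim_add_const_at_top])
  then have "\<forall>\<^sub>F x in at_top. dist (f (x + 1) - f x) (c - c) < \<bar>d\<bar> / 2"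
    by (rule tendstoD) (use d in auto)
  moreover have "\<forall>\<^sub>F x in at_top. dist (f' x) d < \<bar>d\<bar> / 2"
    using f' by (rule tendstoD) (use d in auto)
  ultimately have "\<forall>\<^sub>F x in at_top. dist (f (x + 1) - f x) (c - c) < \<bar>d\<bar> / 2 \<and>
      dist (f' x) d < \<bar>d\<bar> / 2 \<and> (f has_real_derivative f' x) (at x)"
    using df by (intro eventually_conj)
  then obtain X where X: "\<And>x. x \<ge> X \<Longrightarrow> \<bar>f (x + 1) - f x\<bar> < \<bar>d\<bar> / 2 \<and>
      \<bar>f' x - d\<bar> < \<bar>d\<bar> / 2 \<and> (f has_real_derivative f' x) (at x)"
    unfolding eventually_at_top_linorder by (auto simp: dist_real_def)
  obtain z where z: "X < z" "f (X + 1) - f X = (X + 1 - X) * f' z"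
    using MVT2[of X "X + 1" f f'] X by force
  have "f (X + 1) - f X = f' z" using z by simp
  moreover have "\<bar>f (X + 1) - f X\<bar> < \<bar>d\<bar> / 2" "\<bar>f' z - d\<bar> < \<bar>d\<bar> / 2" using X[of X] X[of z] z by auto
  ultimately show False by linarith
qed

text \<open>With a positive limit of the derivative, \<open>f\<close> would eventually be
  nondecreasing and so bounded below.\<close>

lemma derivative_limit_nonpos_if_at_bot:
  fixes f f' :: "real \<Rightarrow> real"
  assumes f: "filterlim f at_bot at_top"
    and df: "\<forall>\<^sub>F x in at_top. (f has_real_derivative f' x) (at x)"
    and f': "(f' \<longlongrightarrow> d) at_top"
  shows "d \<le> 0"
proof (rule ccontr)
  assume "\<not> d \<le> 0"
  then have "\<forall>\<^sub>F x in at_top. 0 < f' x" using order_tendstoD(1)[OF f', of 0] by simp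
  with df have "\<forall>\<^sub>F x in at_top. (f has_real_derivative f' x) (at x) \<and> 0 < f' x"
    by (rule eventually_conj)
  then obtain X where X: "\<And>x. x \<ge> X \<Longrightarrow> (f has_real_derivative f' x) (at x) \<and> 0 < f' x"
    unfolding eventually_at_top_linorder by auto
  have "\<forall>\<^sub>F x in at_top. f x \<le> f X - 1" using f by (simp add: filterlim_at_bot)
  then obtain Y where Y: "\<And>x. x \<ge> Y \<Longrightarrow> f x \<le> f X - 1"
    unfolding eventually_at_top_linorder by auto
  have "f X \<le> f (max X Y)"
    by (rule DERIV_nonneg_imp_nondecreasing) (use X less_imp_le in auto)
  then show False using Y[of "max X Y"] by simp
qed

text \<open>The auxiliary function \<open>\<phi> = 1 - K (T - t)\<^sup>2\<close> satisfies \<open>\<phi>'' \<le> - K \<phi>\<close>, so the Wronskian of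
  \<open>\<phi>\<close> and \<open>u\<close> is monotone and \<open>u / \<phi>\<close> decreases at most linearly.\<close>

lemma supersolution_bounded_below:
  fixes u v w :: "real \<Rightarrow> real"
  assumes a: "a < T" and K: "K > 0"
    and du: "\<And>t. a < t \<Longrightarrow> t < T \<Longrightarrow> (u has_real_derivative v t) (at t)"
    and dv: "\<And>t. a < t \<Longrightarrow> t < T \<Longrightarrow> (v has_real_derivative w t) (at t)"
    and w: "\<And>t. a < t \<Longrightarrow> t < T \<Longrightarrow> w t \<ge> - K * u t"
    and u: "\<And>t. a < t \<Longrightarrow> t < T \<Longrightarrow> u t > 0"
    and lim: "filterlim (\<lambda>t. u t / (T - t)) at_top (at_left T)"
  obtains c C where "c > 0" "\<forall>\<^sub>F t in at_left T. u t \<ge> c \<and> v t \<ge> - C * u t"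
proof -
  define \<phi> where "\<phi> = (\<lambda>t. 1 - K * (T - t)\<^sup>2)"
  define \<phi>' where "\<phi>' = (\<lambda>t. 2 * K * (T - t))"
  have "((\<lambda>t. K * (T - t)\<^sup>2) \<longlongrightarrow> K * (T - T)\<^sup>2) (at_left T)" by (intro tendsto_intros)
  \<comment> \<open>Close to \<open>T\<close> this confines \<open>\<phi>\<close> to the interval
    from 1/2 to 1.\<close>
  then have "\<forall>\<^sub>F t in at_left T. K * (T - t)\<^sup>2 < 1 / 2"
    by (rule order_tendstoD) simp
  then obtain b where b: "b < T" "\<And>t. b < t \<Longrightarrow> t < T \<Longrightarrow> K * (T - t)\<^sup>2 < 1 / 2"
    unfolding eventually_at_left[OF a] by metis
  obtain t1 where t1: "max a b < t1" "t1 < T" using dense[of "max a b" T] a b by auto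
  have \<phi>: "1 / 2 \<le> \<phi> t" "\<phi> t \<le> 1" "0 \<le> \<phi>' t" if "t1 \<le> t" "t < T" for t
  proof -
    have "K * (T - t)\<^sup>2 < 1 / 2" using b(2)[of t] that t1 by simp
    moreover have "0 \<le> K * (T - t)\<^sup>2" "0 \<le> K * (T - t)" using K that by simp_all
    ultimately show "1 / 2 \<le> \<phi> t" "\<phi> t \<le> 1" "0 \<le> \<phi>' t" by (simp_all add: \<phi>_def \<phi>'_def)
  qed
  have d\<phi>: "(\<phi> has_real_derivative \<phi>' t) (at t)" for t
    unfolding \<phi>_def \<phi>'_def by (auto intro!: derivative_eq_intros simp: algebra_simps)
  have d\<phi>': "(\<phi>' has_real_derivative - (2 * K)) (at t)" for t
    unfolding \<phi>'_def by (auto intro!: derivative_eq_intros)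
  define m where "m = (\<lambda>t. \<phi> t * v t - u t * \<phi>' t)"
  have dm: "(m has_real_derivative \<phi> t * w t + 2 * K * u t) (at t)" if "t1 \<le> t" "t < T" for t
  proof -
    have "(u has_real_derivative v t) (at t)" "(v has_real_derivative w t) (at t)"
      using du dv that t1 by auto
    from DERIV_diff[OF DERIV_mult[OF d\<phi> this(2)] DERIV_mult[OF this(1) d\<phi>']]
    show ?thesis by (simp add: m_def algebra_simps)
  qed
  have dm_nonneg: "\<phi> t * w t + 2 * K * u t \<ge> 0" if t: "t1 \<le> t" "t < T" for t
  proof -
    have ut: "u t > 0" using u t t1 by auto
    have "\<phi> t * w t \<ge> \<phi> t * (- K * u t)" using w[of t] \<phi>[OF t] t t1 by (intro mult_left_mono) auto
    moreover have "\<phi> t * (K * u t) \<le> 1 * (K * u t)"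
      using \<phi>[OF t] ut K by (intro mult_right_mono) auto
    moreover have "0 \<le> K * u t" using ut K by simp
    ultimately show ?thesis by simp
  qed
  define M where "M = \<bar>m t1\<bar> + 1"
  have M: "M > 0" by (simp add: M_def)
  have m: "m t \<ge> - M" if t: "t1 \<le> t" "t < T" for t
  proof -
    have "m t1 \<le> m t"
      by (rule DERIV_nonneg_imp_nondecreasing) (use t dm dm_nonneg in force)+
    then show ?thesis by (simp add: M_def)
  qed
  \<comment> \<open>The derivative of \<open>u / \<phi>\<close> is
    \<open>m / \<phi>\<^sup>2\<close>, which is at least \<open>- 4 * M\<close> because
    \<open>m \<ge> - M\<close> and \<open>\<phi> \<ge> 1 / 2\<close>; adding
    \<open>4 * M * t\<close> therefore makes it nondecreasing.\<close>
  have dq: "((\<lambda>t. u t / \<phi> t + 4 * M * t) has_real_derivative m t / (\<phi> t)\<^sup>2 + 4 * M) (at t)"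
    if t: "t1 \<le> t" "t < T" for t
  proof -
    have "(u has_real_derivative v t) (at t)" "\<phi> t \<noteq> 0" using du t t1 \<phi>[OF t] by auto
    from DERIV_add[OF DERIV_divide[OF this(1) d\<phi> this(2)] DERIV_cmult[OF DERIV_ident, of "4 * M"]]
    show ?thesis by (simp add: m_def power2_eq_square mult.commute)
  qed
  have dq_nonneg: "m t / (\<phi> t)\<^sup>2 + 4 * M \<ge> 0" if t: "t1 \<le> t" "t < T" for t
  proof -
    have "(1 / 2)\<^sup>2 \<le> (\<phi> t)\<^sup>2" using \<phi>[OF t] by (intro power_mono) auto
    then have "M * 1 \<le> M * (4 * (\<phi> t)\<^sup>2)" using M by (intro mult_left_mono) (auto simp: power2_eq_square)
    then have "m t + 4 * M * (\<phi> t)\<^sup>2 \<ge> 0" using m[OF t] by simp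
    moreover have "(\<phi> t)\<^sup>2 > 0" using \<phi>[OF t] by simp
    ultimately show ?thesis by (simp add: field_simps)
  qed
  \<comment> \<open>From \<open>t2\<close> onwards \<open>u / \<phi>\<close> loses at most
    \<open>4 * M * (T - t2)\<close>. A starting value of at least \<open>5 * M * (T - t2)\<close>
    leaves \<open>M * (T - t2) = 2 * c\<close>, and multiplying by \<open>\<phi> \<ge> 1 / 2\<close>
    leaves \<open>c\<close>.\<close>
  have "\<forall>\<^sub>F t in at_left T. 5 * M \<le> u t / (T - t)" using lim by (simp add: filterlim_at_top)
  then obtain b' where b': "b' < T" "\<And>t. b' < t \<Longrightarrow> t < T \<Longrightarrow> 5 * M \<le> u t / (T - t)"
    unfolding eventually_at_left[OF a] by metis
  obtain t2 where t2: "max t1 b' < t2" "t2 < T" using dense[of "max t1 b'" T] t1 b' by auto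
  have ut2: "5 * M * (T - t2) \<le> u t2" using b'(2)[of t2] t2 by (simp add: field_simps)
  define c where "c = M * (T - t2) / 2"
  have c: "c > 0" using M t2 by (simp add: c_def)
  have main: "u t \<ge> c \<and> v t \<ge> - (2 * M / c) * u t" if t: "t2 < t" "t < T" for t
  proof -
    have t': "t1 \<le> t" "t1 \<le> t2" using t t2 by auto
    note ph = \<phi>[OF t'(1) t(2)] and ph2 = \<phi>[OF t'(2) t2(2)]
    have "u t2 / \<phi> t2 + 4 * M * t2 \<le> u t / \<phi> t + 4 * M * t"
    proof (rule DERIV_nonneg_imp_nondecreasing[of t2 t "\<lambda>t. u t / \<phi> t + 4 * M * t"])
      fix x assume "t2 \<le> x" "x \<le> t"
      then have "t1 \<le> x" "x < T" using t t' by auto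
      then show "\<exists>y. ((\<lambda>t. u t / \<phi> t + 4 * M * t) has_real_derivative y) (at x) \<and> 0 \<le> y"
        using dq dq_nonneg by blast
    qed (use t in simp)
    moreover have "u t2 \<le> u t2 / \<phi> t2"
    proof -
      have "u t2 * \<phi> t2 \<le> u t2 * 1" using u[of t2] t2 t1 ph2 by (intro mult_left_mono) auto
      then show ?thesis using ph2 by (simp add: field_simps)
    qed
    moreover have "4 * M * (t - t2) \<le> 4 * M * (T - t2)" using M t by (intro mult_left_mono) auto
    ultimately have "M * (T - t2) \<le> u t / \<phi> t" using ut2 by (simp add: algebra_simps)
    then have "2 * c \<le> u t / \<phi> t" by (simp add: c_def)
    then have "2 * c * \<phi> t \<le> u t" using ph by (simp add: field_simps)
    moreover have "2 * c * (1 / 2) \<le> 2 * c * \<phi> t" using c ph by (intro mult_left_mono) auto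
    ultimately have uc: "u t \<ge> c" by simp
    \<comment> \<open>Since \<open>\<phi> * v = m + u * \<phi>'\<close> is at least
      \<open>- M\<close> and \<open>\<phi> \<ge> 1 / 2\<close>, the derivative \<open>v\<close> is
      at least \<open>- 2 * M\<close>; by \<open>u \<ge> c\<close> this constant is absorbed into a
      multiple of \<open>u\<close>.\<close>
    have "u t * \<phi>' t \<ge> 0" using u[of t] t t2 t1 ph by auto
    then have ge: "\<phi> t * v t \<ge> - M" using m[OF t'(1) t(2)] by (simp add: m_def)
    have "v t \<ge> - (2 * M)"
    proof (rule ccontr)
      assume "\<not> - (2 * M) \<le> v t"
      then have v: "v t < - (2 * M)" by simp
      have "\<phi> t * v t \<le> 1 / 2 * v t" using ph v M by (intro mult_right_mono_neg) auto
      then show False using ge v by simp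
    qed
    moreover have "(2 * M / c) * c \<le> (2 * M / c) * u t" using uc M c by (intro mult_left_mono) auto
    ultimately show ?thesis using uc c by simp
  qed
  show ?thesis
  proof
    show "c > 0" by fact
    show "\<forall>\<^sub>F t in at_left T. u t \<ge> c \<and> v t \<ge> - (2 * M / c) * u t"
      unfolding eventually_at_left[OF t2(2)] using main t2(2) by blast
  qed
qed

text \<open>The function \<open>f t + C * ln (T - t)\<close> is nonincreasing, which bounds
  \<open>f\<close> above by a multiple of the logarithm plus a constant; the constant is absorbed
  because \<open>\<bar>ln (T - t)\<bar> \<ge> 1\<close> near \<open>T\<close>. The derivative bound
  is one-sided, so the other side comes from \<open>D\<close>.\<close>

lemma bigo_ln_if_derivative_bounded:
  fixes f f' :: "real \<Rightarrow> real"
  assumes df: "\<forall>\<^sub>F t in at_left T. (f has_real_derivative f' t) (at t)"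
    and f': "\<forall>\<^sub>F t in at_left T. f' t \<le> C / (T - t)"
    and lower: "\<forall>\<^sub>F t in at_left T. D \<le> f t"
  shows "f \<in> O[at_left T](\<lambda>t. ln (T - t))"
proof -
  have T1: "T - 1 < T" by simp
  have "\<forall>\<^sub>F t in at_left T. (f has_real_derivative f' t) (at t) \<and> f' t \<le> C / (T - t) \<and> D \<le> f t"
    using assms by (intro eventually_conj)
  then obtain b where b: "b < T" "\<And>t. b < t \<Longrightarrow> t < T \<Longrightarrow>
      (f has_real_derivative f' t) (at t) \<and> f' t \<le> C / (T - t) \<and> D \<le> f t"
    unfolding eventually_at_left[OF T1] by metis
  obtain t1 where t1: "b < t1" "t1 < T" using dense b by blast
  define E where "E = \<bar>f t1 + C * ln (T - t1)\<bar> + \<bar>D\<bar>"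
  have bd: "\<bar>f t\<bar> \<le> \<bar>C\<bar> * \<bar>ln (T - t)\<bar> + E" if t: "t1 < t" "t < T" for t
  proof -
    have "f t + C * ln (T - t) \<le> f t1 + C * ln (T - t1)"
    proof (rule DERIV_nonpos_imp_nonincreasing[of t1 t "\<lambda>t. f t + C * ln (T - t)"])
      fix x assume x: "t1 \<le> x" "x \<le> t"
      have "((\<lambda>t. f t + C * ln (T - t)) has_real_derivative f' x - C / (T - x)) (at x)"
      proof -
        have "((\<lambda>t. C * ln (T - t)) has_real_derivative - C / (T - x)) (at x)"
          using x t by (auto intro!: derivative_eq_intros)
        from DERIV_add[OF _ this, of f "f' x"] show ?thesis using b(2)[of x] x t t1 by auto
      qed
      then show "\<exists>y. ((\<lambda>t. f t + C * ln (T - t)) has_real_derivative y) (at x) \<and> y \<le> 0"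
        using b(2)[of x] x t t1 by (intro exI conjI) auto
    qed (use t in simp)
    moreover have "\<bar>C * ln (T - t)\<bar> = \<bar>C\<bar> * \<bar>ln (T - t)\<bar>" by (rule abs_mult)
    moreover have "D \<le> f t" using b(2)[of t] t t1 by simp
    ultimately show ?thesis unfolding E_def by linarith
  qed
  have "filterlim (\<lambda>t. - ln (T - t)) at_top (at_left T)" by (rule filterlim_minus_ln_at_left)
  then have "\<forall>\<^sub>F t in at_left T. 1 \<le> - ln (T - t)" unfolding filterlim_at_top by blast
  moreover have "\<forall>\<^sub>F t in at_left T. t1 < t \<and> t < T"
    unfolding eventually_at_left[OF T1] using t1 by blast
  ultimately have "\<forall>\<^sub>F t in at_left T. norm (f t) \<le> (\<bar>C\<bar> + E) * norm (ln (T - t))"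
  proof eventually_elim
    case (elim t)
    have "E * 1 \<le> E * \<bar>ln (T - t)\<bar>" using elim by (intro mult_left_mono) (auto simp: E_def)
    then show ?case using bd[of t] elim by (simp add: algebra_simps)
  qed
  then show ?thesis by (rule bigoI)
qed

lemma decreasing_bounded_tendsto_at_left:
  fixes f :: "real \<Rightarrow> real"
  assumes b: "b < T" and dec: "\<And>x y. b < x \<Longrightarrow> x \<le> y \<Longrightarrow> y < T \<Longrightarrow> f y \<le> f x"
    and bd: "\<And>x. b < x \<Longrightarrow> x < T \<Longrightarrow> m \<le> f x"
  obtains L where "(f \<longlongrightarrow> L) (at_left T)" "m \<le> L"
proof -
  define L where "L = Inf (f ` {b<..<T})"
  have ne: "f ` {b<..<T} \<noteq> {}" using b by simp
  have bdd: "bdd_below (f ` {b<..<T})" using bd by (auto intro!: bdd_belowI[of _ m])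
  have "(f \<longlongrightarrow> L) (at_left T)"
  proof (rule order_tendstoI)
    fix a assume "a < L"
    then have "a < f x" if "b < x" "x < T" for x
      using cInf_lower[OF _ bdd, of "f x"] that unfolding L_def by auto
    then show "\<forall>\<^sub>F x in at_left T. a < f x" unfolding eventually_at_left[OF b] using b by blast
  next
    fix a assume "L < a"
    then obtain x where x: "b < x" "x < T" "f x < a"
      using cInf_lessD[OF ne, of a] unfolding L_def by auto
    then have "f y < a" if "x < y" "y < T" for y using dec[of x y] that by auto
    then show "\<forall>\<^sub>F x in at_left T. f x < a" unfolding eventually_at_left[OF b] using x by blast
  qed
  moreover have "m \<le> L" unfolding L_def using bd by (intro cInf_greatest ne) auto
  ultimately show ?thesis by (rule that)
qed

section \<open>The Wronskian structure\<close>

locale riccati_solution =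
  fixes n :: nat and k cb rho0 T :: real
    and lam0 :: "nat \<Rightarrow> real" and lam :: "nat \<Rightarrow> real \<Rightarrow> real" and rho :: "real \<Rightarrow> real"
  assumes n2: "n \<ge> 2" and kpos: "k > 0" and cbpos: "cb > 0" and rho0pos: "rho0 > 0"
    and T_pos: "0 < T" and sol: "is_solution n k cb rho0 lam0 T lam rho"
begin

abbreviation u where "u \<equiv> uu lam"

definition I where "I i t = integral {0..t} (lam i)"

lemma u_eq_exp: "u i t = exp (I i t)" by (simp add: uu_def I_def)

lemma u_pos [simp]: "u i t > 0" by (simp add: u_eq_exp)

lemma u_nonzero [simp]: "u i t \<noteq> 0" by (simp add: u_eq_exp)

lemma I_0 [simp]: "I i 0 = 0" by (simp add: I_def)

lemma u_0 [simp]: "u i 0 = 1" by (simp add: u_eq_exp)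

lemma lam_within:
  "i \<in> {1..n} \<Longrightarrow> t \<in> {0..<T} \<Longrightarrow>
    (lam i has_real_derivative (- (lam i t)\<^sup>2 + k / real n * (rho t - cb))) (at t within {0..<T})"
  using sol by (simp add: is_solution_def)

lemma rho_within:
  "t \<in> {0..<T} \<Longrightarrow> (rho has_real_derivative (- rho t * (\<Sum>i\<in>{1..n}. lam i t))) (at t within {0..<T})"
  using sol by (simp add: is_solution_def)

lemma lam_0: "i \<in> {1..n} \<Longrightarrow> lam i 0 = lam0 i" and rho_0: "rho 0 = rho0"
  using sol by (simp_all add: is_solution_def)

lemma at_within_T: "0 < t \<Longrightarrow> t < T \<Longrightarrow> at t within {0..<T} = at t"
  by (rule at_within_interior) auto

lemma lam_cont: "i \<in> {1..n} \<Longrightarrow> continuous_on {0..<T} (lam i)"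
  by (rule DERIV_continuous_on) (rule lam_within)

lemma I_within:
  assumes i: "i \<in> {1..n}" and t: "t \<in> {0..<T}"
  shows "(I i has_real_derivative lam i t) (at t within {0..<T})"
proof -
  \<comment> \<open>The integral is differentiated on the compact interval \<open>{0..b}\<close>,
    which coincides with \<open>{0..<T}\<close> near \<open>t\<close>.\<close>
  define b where "b = (t + T) / 2"
  have b: "t < b" "b < T" using t by (auto simp: b_def)
  have "continuous_on {0..b} (lam i)" using lam_cont[OF i] b by (rule_tac continuous_on_subset) auto
  then have "((\<lambda>x. integral {0..x} (lam i)) has_real_derivative lam i t) (at t within {0..b})"
    using t b by (intro integral_has_real_derivative) auto
  moreover have "at t within {0..b} = at t within {0..<T}"
    using t b by (intro at_within_nhd[of t "{..<b}"]) auto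
  ultimately show ?thesis by (simp add: I_def[abs_def])
qed

lemma u_within:
  assumes "i \<in> {1..n}" "t \<in> {0..<T}"
  shows "(u i has_real_derivative lam i t * u i t) (at t within {0..<T})"
  using DERIV_chain2[OF DERIV_exp I_within[OF assms]] unfolding u_eq_exp[abs_def] by (simp add: mult.commute)

lemma zero_derivative_const:
  assumes "\<And>t. t \<in> {0..<T} \<Longrightarrow> (f has_real_derivative 0) (at t within {0..<T})" "t \<in> {0..<T}"
  shows "f t = f (0::real)"
  using has_field_derivative_zero_constant[of "{0..<T}" f] assms T_pos by fastforce

text \<open>The left-hand side is the Wronskian \<open>u i * u j' - u i' * u j\<close> written with
  logarithmic derivatives. It is constant because the Riccati equations share the same forcing term,
  and its value is read off at time 0.\<close>

lemma wronskian:
  assumes ij: "i \<in> {1..n}" "j \<in> {1..n}" and t: "t \<in> {0..<T}"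
  shows "(lam j t - lam i t) * (u i t * u j t) = lam0 j - lam0 i"
proof -
  have "(lam j t - lam i t) * (u i t * u j t) = (lam j 0 - lam i 0) * (u i 0 * u j 0)"
  proof (rule zero_derivative_const[OF _ t])
    fix t assume t: "t \<in> {0..<T}"
    show "((\<lambda>t. (lam j t - lam i t) * (u i t * u j t)) has_real_derivative 0) (at t within {0..<T})"
      using DERIV_mult[OF DERIV_diff[OF lam_within[OF ij(2) t] lam_within[OF ij(1) t]]
          DERIV_mult[OF u_within[OF ij(1) t] u_within[OF ij(2) t]]]
      by (rule DERIV_cong) (simp add: algebra_simps power2_eq_square)
  qed
  then show ?thesis using ij by (simp add: lam_0)
qed

lemma lam_diff:
  assumes "i \<in> {1..n}" "j \<in> {1..n}" "t \<in> {0..<T}"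
  shows "lam j t = lam i t + (lam0 j - lam0 i) / (u i t * u j t)"
  using wronskian[OF assms] by (simp add: field_simps)

text \<open>\<open>rho\<close> and the product of the \<open>u i\<close> have opposite logarithmic
  derivatives.\<close>

lemma rho_prod:
  assumes t: "t \<in> {0..<T}"
  shows "rho t * (\<Prod>i\<in>{1..n}. u i t) = rho0"
proof -
  have "rho t * exp (\<Sum>i\<in>{1..n}. I i t) = rho 0 * exp (\<Sum>i\<in>{1..n}. I i 0)"
  proof (rule zero_derivative_const[OF _ t])
    fix t assume t: "t \<in> {0..<T}"
    have "((\<lambda>t. \<Sum>i\<in>{1..n}. I i t) has_real_derivative (\<Sum>i\<in>{1..n}. lam i t)) (at t within {0..<T})"
      by (intro DERIV_sum I_within t)
    from DERIV_mult[OF rho_within[OF t] DERIV_chain2[OF DERIV_exp this]]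
    show "((\<lambda>t. rho t * exp (\<Sum>i\<in>{1..n}. I i t)) has_real_derivative 0) (at t within {0..<T})"
      by (rule DERIV_cong) (simp add: algebra_simps)
  qed
  then show ?thesis by (simp add: exp_sum u_eq_exp rho_0)
qed

lemma rho_eq: "t \<in> {0..<T} \<Longrightarrow> rho t = rho0 / (\<Prod>i\<in>{1..n}. u i t)"
  using rho_prod[of t] by (simp add: field_simps)

lemma rho_pos: "t \<in> {0..<T} \<Longrightarrow> rho t > 0"
  using rho0pos by (simp add: rho_eq prod_pos)

lemma lam_mono:
  assumes "i \<in> {1..n}" "j \<in> {1..n}" "t \<in> {0..<T}" "lam0 i \<le> lam0 j"
  shows "lam i t \<le> lam j t"
  using lam_diff[OF assms(1-3)] assms(4) by (simp add: less_imp_le)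

text \<open>By \<open>wronskian\<close>, the derivatives of \<open>u i / u n\<close> and
  \<open>u 1 / u n\<close> are both constants divided by \<open>(u n)\<^sup>2\<close>. Hence a
  suitable combination of the two quotients is constant, with value determined at time 0.\<close>

lemma u_combination:
  assumes ij: "i \<in> {1..n}" and t: "t \<in> {0..<T}" and ne: "lam0 n \<noteq> lam0 1"
  shows "u i t = (lam0 n - lam0 i) / (lam0 n - lam0 1) * u 1 t + (lam0 i - lam0 1) / (lam0 n - lam0 1) * u n t"
proof -
  define a where "a = (lam0 n - lam0 i) / (lam0 n - lam0 1)"
  have n1: "n \<in> {1..n}" "1 \<in> {1..n}" using n2 by auto
  have quot: "((\<lambda>t. u i t / u n t) has_real_derivative (lam0 i - lam0 n) / (u n t * u n t))
      (at t within {0..<T})" if i: "i \<in> {1..n}" and t: "t \<in> {0..<T}" for i t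
  proof -
    have "(lam i t * u i t * u n t - u i t * (lam n t * u n t)) / (u n t * u n t)
        = (lam i t - lam n t) * (u n t * u i t) / (u n t * u n t)" by (simp add: algebra_simps)
    also have "\<dots> = (lam0 i - lam0 n) / (u n t * u n t)" by (simp only: wronskian[OF n1(1) i t])
    finally show ?thesis
      using DERIV_divide[OF u_within[OF i t] u_within[OF n1(1) t]] by simp
  qed
  have "u i t / u n t - a * (u 1 t / u n t) = u i 0 / u n 0 - a * (u 1 0 / u n 0)"
  proof (rule zero_derivative_const[OF _ t])
    fix t assume t: "t \<in> {0..<T}"
    have "a * ((lam0 1 - lam0 n) / (u n t * u n t)) = (lam0 i - lam0 n) / (u n t * u n t)"
      using ne by (simp add: a_def field_simps)
    then show "((\<lambda>t. u i t / u n t - a * (u 1 t / u n t)) has_real_derivative 0) (at t within {0..<T})"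
      using DERIV_diff[OF quot[OF ij t] DERIV_cmult[OF quot[OF n1(2) t], of a]] by simp
  qed
  then have "u i t = a * u 1 t + (1 - a) * u n t" by (simp add: field_simps)
  moreover have "1 - a = (lam0 i - lam0 1) / (lam0 n - lam0 1)" using ne by (simp add: a_def field_simps)
  ultimately show ?thesis by (simp add: a_def)
qed

lemma ev_left: "\<forall>\<^sub>F t in at_left T. 0 < t \<and> t < T"
  unfolding eventually_at_left[OF T_pos] using T_pos by blast

lemma deriv_u: "i \<in> {1..n} \<Longrightarrow> 0 < t \<Longrightarrow> t < T \<Longrightarrow> deriv (u i) t = lam i t * u i t"
  using u_within[of i t] by (intro DERIV_imp_deriv) (simp add: at_within_T)

text \<open>A bound on the \<open>lam i\<close> also bounds \<open>rho\<close>: the sum of the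
  \<open>lam i\<close> is at least \<open>- K\<close>, so \<open>rho t * exp (- K * t)\<close> is
  nonincreasing, and the time interval is finite.\<close>

lemma bounded_lam_imp_extends:
  assumes M: "\<And>i. i \<in> {1..n} \<Longrightarrow> \<forall>\<^sub>F t in at_left T. \<bar>lam i t\<bar> \<le> M"
  shows "\<exists>T' > T. \<exists>lam' rho'. is_solution n k cb rho0 lam0 T' lam' rho'"
proof -
  have "\<forall>\<^sub>F t in at_left T. (0 < t \<and> t < T) \<and> (\<forall>i\<in>{1..n}. \<bar>lam i t\<bar> \<le> M)"
    using M ev_left by (simp add: eventually_conj_iff eventually_ball_finite_distrib)
  then obtain b where b: "b < T" "\<And>t. b < t \<Longrightarrow> t < T \<Longrightarrow> (0 < t \<and> t < T) \<and> (\<forall>i\<in>{1..n}. \<bar>lam i t\<bar> \<le> M)"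
    unfolding eventually_at_left[OF T_pos] by metis
  obtain t1 where t1: "b < t1" "t1 < T" using dense b by blast
  define K where "K = real n * M"
  have sum_ge: "- K \<le> (\<Sum>i\<in>{1..n}. lam i t)" if "b < t" "t < T" for t
  proof -
    have "(\<Sum>i\<in>{1..n}. - M) \<le> (\<Sum>i\<in>{1..n}. lam i t)" 
      using b(2)[OF that] by (intro sum_mono) (simp add: minus_le_iff abs_le_iff)
    then show ?thesis by (simp add: K_def)
  qed
  define B where "B = \<bar>rho t1 * exp (- K * t1)\<bar> * exp (\<bar>K\<bar> * T)"
  have rho_le: "\<bar>rho t\<bar> \<le> B" if t: "t1 < t" "t < T" for t
  proof -
    have "rho t * exp (- K * t) \<le> rho t1 * exp (- K * t1)"
    proof (rule DERIV_nonpos_imp_nonincreasing[of t1 t "\<lambda>t. rho t * exp (- K * t)"])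
      fix x assume "t1 \<le> x" "x \<le> t"
      then have x: "b < x" "0 < x" "x < T" using t t1 b(2)[of x] by auto
      have "((\<lambda>t. exp (- K * t)) has_real_derivative exp (- K * x) * - K) (at x)"
        by (intro DERIV_fun_exp DERIV_cmult_Id)
      from DERIV_mult[OF rho_within[of x, unfolded at_within_T[OF x(2,3)]] this]
      have "((\<lambda>t. rho t * exp (- K * t)) has_real_derivative
          - (rho x * exp (- K * x) * ((\<Sum>i\<in>{1..n}. lam i x) + K))) (at x)"
        using x by (simp add: algebra_simps)
      moreover have "0 \<le> rho x * exp (- K * x) * ((\<Sum>i\<in>{1..n}. lam i x) + K)"
        using rho_pos[of x] sum_ge[of x] x by (intro mult_nonneg_nonneg) auto
      ultimately show "\<exists>y. ((\<lambda>t. rho t * exp (- K * t)) has_real_derivative y) (at x) \<and> y \<le> 0"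
        by (metis neg_le_0_iff_le)
    qed (use t in simp)
    then have "rho t * exp (- K * t) * exp (K * t) \<le> \<bar>rho t1 * exp (- K * t1)\<bar> * exp (K * t)"
      by (intro mult_right_mono) auto
    moreover have "rho t * exp (- K * t) * exp (K * t) = rho t"
      by (simp add: exp_minus field_simps)
    moreover have "\<bar>rho t1 * exp (- K * t1)\<bar> * exp (K * t) \<le> B"
    proof -
      have t0: "0 < t" using b(2)[of t] t t1 by auto
      have "K * t \<le> \<bar>K\<bar> * t" using t0 by (intro mult_right_mono) auto
      also have "\<dots> \<le> \<bar>K\<bar> * T" using t by (intro mult_left_mono) auto
      finally show ?thesis unfolding B_def by (intro mult_left_mono) auto
    qed
    moreover have "0 < rho t" using rho_pos[of t] b(2)[of t] t t1 by auto
    ultimately show ?thesis by linarith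
  qed
  have "\<forall>\<^sub>F t in at_left T. \<bar>rho t\<bar> \<le> max M B"
    unfolding eventually_at_left[OF T_pos] using rho_le t1
    by (intro exI[of _ t1]) (auto simp: le_max_iff_disj)
  moreover have "\<forall>\<^sub>F t in at_left T. \<bar>lam i t\<bar> \<le> max M B" if "i \<in> {1..n}" for i
    using M[OF that] by eventually_elim simp
  ultimately show ?thesis by (intro bounded_solution_extends[OF sol T_pos])
qed

end

section \<open>Leading-order behaviour at the blow-up time\<close>

text \<open>Keeps the index in terms such as \<open>u 1\<close> from being rewritten to
  \<open>Suc 0\<close>.\<close>

declare One_nat_def [simp del]

locale riccati_blowup = riccati_solution +
  fixes J :: nat and p q :: real
  assumes J: "1 \<le> J" "J \<le> n"
    and init_eq: "\<forall>i\<in>{1..J}. lam0 i = lam0 1"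
    and init_gap: "J < n \<longrightarrow> lam0 J < lam0 (J + 1)"
    and init_mono: "\<forall>i j. J + 1 \<le> i \<and> i \<le> j \<and> j \<le> n \<longrightarrow> lam0 i \<le> lam0 j"
    and maximal: "\<not> (\<exists>T' > T. \<exists>lam' rho'. is_solution n k cb rho0 lam0 T' lam' rho')"
    and lim_p: "((\<lambda>t. deriv (uu lam 1) t * uu lam n t) \<longlongrightarrow> - p) (at_left T)"
    and lim_q: "((\<lambda>t. uu lam 1 t * deriv (uu lam n) t) \<longlongrightarrow> q) (at_left T)"
    and q_nonneg: "0 \<le> q" and pq: "p > q"
begin

definition xi1 where "xi1 = - p / (p - q)"
definition xin where "xin = q / (p - q)"
text \<open>The coefficient of \<open>u n\<close> in \<open>u_combination\<close>; it turns out to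
  be the limit of \<open>u i / u n\<close> at \<open>T\<close>.\<close>

definition wt where "wt i = (lam0 i - lam0 1) / (lam0 n - lam0 1)"
text \<open>The limit of \<open>(T - t)\<close> times the sum of all \<open>lam i\<close>, with
  \<open>J\<close> summands contributing \<open>xi1\<close> and the others
  \<open>xin\<close>.\<close>

definition gam where "gam = real J * xi1 + (real n - real J) * xin"

section \<open>Consequences of the limits \<open>p\<close> and \<open>q\<close> for the initial
  data\<close>

lemma n1_mem [simp]: "n \<in> {1..n}" "1 \<in> {1..n}" using n2 by auto

lemma left_ne: "at_left T \<noteq> bot" by simp

text \<open>Because the two numbers add up to -1, they give the same value to
  \<open>x\<^sup>2 + x\<close>; everything below is expressed through \<open>xin\<close>
  alone.\<close>

lemma xi_simps: "xi1 = - 1 - xin" "xin \<ge> 0"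
  using pq q_nonneg by (auto simp: xi1_def xin_def field_simps)

lemma lim_p': "((\<lambda>t. lam 1 t * (u 1 t * u n t)) \<longlongrightarrow> - p) (at_left T)"
proof (rule Lim_transform_eventually[OF lim_p])
  show "\<forall>\<^sub>F t in at_left T. deriv (u 1) t * u n t = lam 1 t * (u 1 t * u n t)"
    using ev_left by eventually_elim (use n2 in \<open>simp add: deriv_u\<close>)
qed

lemma lim_q': "((\<lambda>t. lam n t * (u 1 t * u n t)) \<longlongrightarrow> q) (at_left T)"
proof (rule Lim_transform_eventually[OF lim_q])
  show "\<forall>\<^sub>F t in at_left T. u 1 t * deriv (u n) t = lam n t * (u 1 t * u n t)"
    using ev_left by eventually_elim (use n2 in \<open>simp add: deriv_u\<close>)
qed

text \<open>The difference of the two functions with limits \<open>q\<close> and \<open>- p\<close>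
  is the Wronskian of \<open>u 1\<close> and \<open>u n\<close>, a constant.\<close>

lemma gap_eq: "lam0 n - lam0 1 = p + q"
proof -
  have "((\<lambda>t. lam n t * (u 1 t * u n t) - lam 1 t * (u 1 t * u n t)) \<longlongrightarrow> q - - p) (at_left T)"
    by (intro tendsto_diff lim_p' lim_q')
  moreover have "\<forall>\<^sub>F t in at_left T. lam n t * (u 1 t * u n t) - lam 1 t * (u 1 t * u n t) = lam0 n - lam0 1"
    using ev_left
    by eventually_elim (use wronskian[OF n1_mem(2,1)] in \<open>simp add: left_diff_distrib\<close>)
  ultimately have "((\<lambda>t. lam0 n - lam0 1) \<longlongrightarrow> q - - p) (at_left T)"
    by (rule Lim_transform_eventually)
  then show ?thesis using tendsto_unique[OF left_ne tendsto_const] by fastforce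
qed

lemma gap_pos: "lam0 n - lam0 1 > 0" using gap_eq pq q_nonneg by simp

lemma J_less: "J < n"
proof (rule ccontr)
  assume "\<not> J < n"
  then have "n \<in> {1..J}" using J n2 by auto
  then have "lam0 n = lam0 1" using init_eq by blast
  then show False using gap_pos by simp
qed

lemma lam0_low: "i \<in> {1..J} \<Longrightarrow> lam0 i = lam0 1" using init_eq by blast

lemma lam0_gt:
  assumes "i \<in> {J<..n}" shows "lam0 1 < lam0 i"
proof -
  have "lam0 1 = lam0 J" using lam0_low[of J] J by simp
  also have "\<dots> < lam0 (J + 1)" using init_gap J_less by blast
  also have "\<dots> \<le> lam0 i" using init_mono assms by simp
  finally show ?thesis .
qed

lemma lam0_bounds:
  assumes "i \<in> {1..n}" shows "lam0 1 \<le> lam0 i" "lam0 i \<le> lam0 n"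
proof -
  consider "i \<in> {1..J}" | "i \<in> {J<..n}" using assms by force
  then have "lam0 1 \<le> lam0 i \<and> lam0 i \<le> lam0 n"
  proof cases
    case 1
    then show ?thesis using lam0_low[OF 1] gap_pos by simp
  next
    case 2
    then show ?thesis using lam0_gt[OF 2] init_mono by simp
  qed
  then show "lam0 1 \<le> lam0 i" "lam0 i \<le> lam0 n" by auto
qed

lemma wt_pos: "i \<in> {J<..n} \<Longrightarrow> wt i > 0"
  using lam0_gt gap_pos by (simp add: wt_def)

section \<open>Decay of the product \<open>u 1 * u n\<close> and growth rates of the
  \<open>lam i\<close>\<close>

lemma product_deriv:
  "0 < t \<Longrightarrow> t < T \<Longrightarrow> ((\<lambda>t. u 1 t * u n t) has_real_derivative
     lam 1 t * (u 1 t * u n t) + lam n t * (u 1 t * u n t)) (at t)"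
  using DERIV_mult[OF u_within[OF n1_mem(2), of t] u_within[OF n1_mem(1), of t]]
  by (simp add: at_within_T algebra_simps)

lemma product_deriv_lim:
  "((\<lambda>t. lam 1 t * (u 1 t * u n t) + lam n t * (u 1 t * u n t)) \<longlongrightarrow> q - p) (at_left T)"
  using tendsto_add[OF lim_p' lim_q'] by simp

lemma product_tendsto_0: "((\<lambda>t. u 1 t * u n t) \<longlongrightarrow> 0) (at_left T)"
proof -
  have "\<forall>\<^sub>F t in at_left T. lam 1 t * (u 1 t * u n t) + lam n t * (u 1 t * u n t) < 0"
    using order_tendstoD(2)[OF product_deriv_lim, of 0] pq by simp
  with ev_left have "\<forall>\<^sub>F t in at_left T. (0 < t \<and> t < T) \<and>
      lam 1 t * (u 1 t * u n t) + lam n t * (u 1 t * u n t) < 0"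
    by (rule eventually_conj)
  then obtain b where b: "b < T" "\<And>t. b < t \<Longrightarrow> t < T \<Longrightarrow> (0 < t \<and> t < T) \<and>
      lam 1 t * (u 1 t * u n t) + lam n t * (u 1 t * u n t) < 0"
    unfolding eventually_at_left[OF T_pos] by metis
  obtain L where L: "((\<lambda>t. u 1 t * u n t) \<longlongrightarrow> L) (at_left T)" "0 \<le> L"
  proof (rule decreasing_bounded_tendsto_at_left[OF b(1), of "\<lambda>t. u 1 t * u n t" 0])
    fix x y assume xy: "b < x" "x \<le> y" "y < T"
    show "u 1 y * u n y \<le> u 1 x * u n x"
    proof (rule DERIV_nonpos_imp_nonincreasing[OF xy(2), of "\<lambda>t. u 1 t * u n t"])
      fix z assume "x \<le> z" "z \<le> y"
      then have z: "b < z" "z < T" using xy by auto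
      then show "\<exists>y. ((\<lambda>t. u 1 t * u n t) has_real_derivative y) (at z) \<and> y \<le> 0"
        using product_deriv[of z] b(2)[OF z] less_imp_le by blast
    qed
  qed (simp_all add: less_imp_le)
  have "L = 0"
  proof (rule ccontr)
    assume "L \<noteq> 0"
    \<comment> \<open>If \<open>L\<close> were nonzero, dividing by the product would make
      \<open>lam 1\<close> and \<open>lam n\<close> converge. By \<open>lam_mono\<close> all other
      \<open>lam i\<close> lie between these two, so the solution would be extendable, against
      maximality.\<close>
    have quot: "((\<lambda>t. lam i t) \<longlongrightarrow> c / L) (at_left T)"
      if "((\<lambda>t. lam i t * (u 1 t * u n t)) \<longlongrightarrow> c) (at_left T)" for i c
      using tendsto_divide[OF that L(1) \<open>L \<noteq> 0\<close>] by simp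
    have "\<forall>\<^sub>F t in at_left T. - p / L - 1 < lam 1 t"
      by (rule order_tendstoD(1)[OF quot[OF lim_p']]) simp
    moreover have "\<forall>\<^sub>F t in at_left T. lam n t < q / L + 1"
      by (rule order_tendstoD(2)[OF quot[OF lim_q']]) simp
    ultimately have "\<forall>\<^sub>F t in at_left T. \<bar>lam i t\<bar> \<le> max (p / L + 1) (q / L + 1)" if i: "i \<in> {1..n}" for i
      using ev_left
    proof eventually_elim
      case (elim t)
      then have "lam 1 t \<le> lam i t" "lam i t \<le> lam n t"
        using lam_mono lam0_bounds[OF i] i n1_mem by auto
      then have "lam i t \<le> q / L + 1" "- lam i t \<le> p / L + 1" using elim by linarith+
      then show ?case by (smt (verit))
    qed
    then have "\<exists>T' > T. \<exists>lam' rho'. is_solution n k cb rho0 lam0 T' lam' rho'"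
      by (rule bounded_lam_imp_extends)
    then show False using maximal by blast
  qed
  then show ?thesis using L by simp
qed

lemma T_minus_tendsto: "((\<lambda>t. T - t) \<longlongrightarrow> 0) (at_left T)"
  using tendsto_diff[OF tendsto_const tendsto_ident_at, of T T "{..<T}"] by simp

lemma product_asymp: "((\<lambda>t. u 1 t * u n t / (T - t)) \<longlongrightarrow> p - q) (at_left T)"
proof (rule lhopital_left[where f' = "\<lambda>t. lam 1 t * (u 1 t * u n t) + lam n t * (u 1 t * u n t)" and g' = "\<lambda>_. -1"])
  show "\<forall>\<^sub>F t in at_left T. ((\<lambda>t. u 1 t * u n t) has_real_derivative
      lam 1 t * (u 1 t * u n t) + lam n t * (u 1 t * u n t)) (at t)"
    using ev_left by eventually_elim (simp add: product_deriv)
  show "\<forall>\<^sub>F t in at_left T. ((\<lambda>t. T - t) has_real_derivative - 1) (at t)"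
    by (intro always_eventually allI) (auto intro!: derivative_eq_intros)
  show "((\<lambda>t. (lam 1 t * (u 1 t * u n t) + lam n t * (u 1 t * u n t)) / - 1) \<longlongrightarrow> p - q) (at_left T)"
    using tendsto_minus[OF product_deriv_lim] by simp
  show "\<forall>\<^sub>F t in at_left T. T - t \<noteq> 0" using ev_left by eventually_elim simp
qed (use product_tendsto_0 T_minus_tendsto in auto)

lemma inverse_product_asymp: "((\<lambda>t. (T - t) / (u 1 t * u n t)) \<longlongrightarrow> 1 / (p - q)) (at_left T)"
  using tendsto_inverse[OF product_asymp] pq by (simp add: inverse_eq_divide)

lemma lam_1_asymp: "((\<lambda>t. (T - t) * lam 1 t) \<longlongrightarrow> xi1) (at_left T)"
  using tendsto_mult[OF lim_p' inverse_product_asymp] by (simp add: xi1_def mult_ac)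

lemma lam_n_asymp: "((\<lambda>t. (T - t) * lam n t) \<longlongrightarrow> xin) (at_left T)"
  using tendsto_mult[OF lim_q' inverse_product_asymp] by (simp add: xin_def mult_ac)

text \<open>The logarithm of \<open>u 1 / u n\<close> has derivative \<open>lam 1 - lam n\<close>,
  minus the initial gap divided by \<open>u 1 * u n\<close>. As the product is below
  \<open>(p - q + 1) * (T - t)\<close> near \<open>T\<close>, this is at most
  \<open>- \<kappa> / (T - t)\<close>, whose integral diverges to minus infinity.\<close>

lemma ratio_tendsto_0: "((\<lambda>t. u 1 t / u n t) \<longlongrightarrow> 0) (at_left T)"
proof -
  define \<kappa> where "\<kappa> = (lam0 n - lam0 1) / (p - q + 1)"
  have \<kappa>: "\<kappa> > 0" using gap_pos pq by (simp add: \<kappa>_def)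
  have "\<forall>\<^sub>F t in at_left T. u 1 t * u n t / (T - t) < p - q + 1"
    using order_tendstoD(2)[OF product_asymp, of "p - q + 1"] by simp
  with ev_left have "\<forall>\<^sub>F t in at_left T. (0 < t \<and> t < T) \<and> u 1 t * u n t / (T - t) < p - q + 1"
    by (rule eventually_conj)
  then obtain b where b: "b < T" "\<And>t. b < t \<Longrightarrow> t < T \<Longrightarrow> (0 < t \<and> t < T) \<and> u 1 t * u n t / (T - t) < p - q + 1"
    unfolding eventually_at_left[OF T_pos] by metis
  obtain t1 where t1: "b < t1" "t1 < T" using dense b by blast
  define h where "h = (\<lambda>t. I 1 t - I n t - \<kappa> * ln (T - t))"
  have h: "h t \<le> h t1" if t: "t1 < t" "t < T" for t
  proof (rule DERIV_nonpos_imp_nonincreasing[of t1 t h])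
    fix x assume "t1 \<le> x" "x \<le> t"
    then have x: "0 < x" "x < T" "u 1 x * u n x / (T - x) < p - q + 1" using t t1 b(2)[of x] by auto
    have dl: "((\<lambda>t. \<kappa> * ln (T - t)) has_real_derivative - \<kappa> / (T - x)) (at x)"
      using x by (auto intro!: derivative_eq_intros)
    have "(h has_real_derivative lam 1 x - lam n x - - \<kappa> / (T - x)) (at x)"
      unfolding h_def
      using DERIV_diff[OF DERIV_diff[OF I_within[OF n1_mem(2)] I_within[OF n1_mem(1)]], of x, unfolded at_within_T[OF x(1,2)], OF _ _ dl] x by simp
    moreover have "\<kappa> / (T - x) \<le> (lam0 n - lam0 1) / (u 1 x * u n x)"
    proof -
      have "u 1 x * u n x \<le> (p - q + 1) * (T - x)" using x by (simp add: field_simps)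
      then have "(lam0 n - lam0 1) / ((p - q + 1) * (T - x)) \<le> (lam0 n - lam0 1) / (u 1 x * u n x)"
        using gap_pos x pq by (intro divide_left_mono) (auto intro!: mult_pos_pos)
      then show ?thesis by (simp add: \<kappa>_def)
    qed
    ultimately show "\<exists>y. (h has_real_derivative y) (at x) \<and> y \<le> 0"
      using lam_diff[OF n1_mem(2,1), of x] x by (intro exI conjI) auto
  qed (use t in simp)
  have "filterlim (\<lambda>t. \<kappa> * - ln (T - t)) at_top (at_left T)"
    by (rule filterlim_tendsto_pos_mult_at_top[OF tendsto_const \<kappa> filterlim_minus_ln_at_left])
  then have "filterlim (\<lambda>t. - h t1 + \<kappa> * - ln (T - t)) at_top (at_left T)"
    by (rule filterlim_tendsto_add_at_top[OF tendsto_const])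
  moreover have "\<forall>\<^sub>F t in at_left T. - h t1 + \<kappa> * - ln (T - t) \<le> - (I 1 t - I n t)"
    unfolding eventually_at_left[OF T_pos]
  proof (intro exI[of _ t1] conjI allI impI)
    fix t assume "t1 < t" "t < T"
    then show "- h t1 + \<kappa> * - ln (T - t) \<le> - (I 1 t - I n t)" using h[of t] unfolding h_def by linarith
  qed (rule t1(2))
  ultimately have "filterlim (\<lambda>t. - (I 1 t - I n t)) at_top (at_left T)"
    by (rule filterlim_at_top_mono)
  then have "filterlim (\<lambda>t. I 1 t - I n t) at_bot (at_left T)"
    by (simp only: filterlim_uminus_at_bot)
  then have "((\<lambda>t. exp (I 1 t - I n t)) \<longlongrightarrow> 0) (at_left T)"
    by (rule filterlim_compose[OF exp_at_bot])
  then show ?thesis by (simp add: u_eq_exp exp_diff)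
qed

text \<open>The square of \<open>u 1\<close> is the product \<open>u 1 * u n\<close> times the ratio
  \<open>u 1 / u n\<close>, and both tend to 0.\<close>

lemma u_1_tendsto_0: "((\<lambda>t. u 1 t) \<longlongrightarrow> 0) (at_left T)"
proof -
  have "((\<lambda>t. (u 1 t * u n t) * (u 1 t / u n t)) \<longlongrightarrow> 0 * 0) (at_left T)"
    by (intro tendsto_mult product_tendsto_0 ratio_tendsto_0)
  then have "((\<lambda>t. sqrt ((u 1 t)\<^sup>2)) \<longlongrightarrow> sqrt 0) (at_left T)"
    by (intro tendsto_real_sqrt) (simp add: power2_eq_square)
  then show ?thesis by (simp add: less_imp_le)
qed

lemma u_ratio_tendsto:
  assumes "i \<in> {1..n}"
  shows "((\<lambda>t. u i t / u n t) \<longlongrightarrow> wt i) (at_left T)"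
proof (rule Lim_transform_eventually)
  show "((\<lambda>t. (lam0 n - lam0 i) / (lam0 n - lam0 1) * (u 1 t / u n t) + wt i) \<longlongrightarrow> wt i) (at_left T)"
    by (rule tendsto_eq_rhs[OF tendsto_add[OF tendsto_mult[OF tendsto_const ratio_tendsto_0] tendsto_const]]) simp
  show "\<forall>\<^sub>F t in at_left T. (lam0 n - lam0 i) / (lam0 n - lam0 1) * (u 1 t / u n t) + wt i = u i t / u n t"
    using ev_left
  proof eventually_elim
    case (elim t)
    then have "u i t = (lam0 n - lam0 i) / (lam0 n - lam0 1) * u 1 t + wt i * u n t"
      using u_combination[OF assms, of t] gap_pos by (simp add: wt_def)
    then show ?case by (simp add: add_divide_distrib)
  qed
qed

text \<open>Factor the quotient as \<open>u i / u n\<close> times \<open>u 1 * u n / (T - t)\<close>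
  times \<open>1 / u 1\<close>: the first two factors have positive limits and the last one
  diverges. This is the growth condition of \<open>supersolution_bounded_below\<close>.\<close>

lemma u_over_dist_at_top:
  assumes i: "i \<in> {J<..n}"
  shows "filterlim (\<lambda>t. u i t / (T - t)) at_top (at_left T)"
proof -
  have "filterlim (\<lambda>t. u 1 t) (at_right 0) (at_left T)"
    by (rule tendsto_imp_filterlim_at_right[OF u_1_tendsto_0]) simp
  then have "filterlim (\<lambda>t. inverse (u 1 t)) at_top (at_left T)"
    by (rule filterlim_compose[OF filterlim_inverse_at_top_right])
  then have "filterlim (\<lambda>t. u 1 t * u n t / (T - t) * inverse (u 1 t)) at_top (at_left T)"
    by (rule filterlim_tendsto_pos_mult_at_top[OF product_asymp, rotated]) (use pq in simp)
  then have "filterlim (\<lambda>t. u i t / u n t * (u 1 t * u n t / (T - t) * inverse (u 1 t))) at_top (at_left T)"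
    by (rule filterlim_tendsto_pos_mult_at_top[OF u_ratio_tendsto wt_pos, rotated 2])
       (use i J in auto)
  moreover have "u i t / u n t * (u 1 t * u n t / (T - t) * inverse (u 1 t)) = u i t / (T - t)" for t
    by (simp add: divide_simps)
  ultimately show ?thesis by simp
qed

text \<open>By \<open>lam_diff\<close>, \<open>lam i\<close> and \<open>lam n\<close> differ by a
  constant over \<open>u n * u i\<close>. Since \<open>u n * u i\<close> is of larger order than
  \<open>u 1 * u n\<close>, the difference vanishes after multiplication by
  \<open>T - t\<close>.\<close>

lemma lam_asymp:
  assumes i: "i \<in> {J<..n}"
  shows "((\<lambda>t. (T - t) * lam i t) \<longlongrightarrow> xin) (at_left T)"
proof -
  have i': "i \<in> {1..n}" using i by auto
  have wt: "wt i \<noteq> 0" using wt_pos[OF i] by simp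
  have "((\<lambda>t. (T - t) * lam n t + (lam0 i - lam0 n) *
        ((T - t) / (u 1 t * u n t) * (u 1 t / u n t) / (u i t / u n t)))
      \<longlongrightarrow> xin + (lam0 i - lam0 n) * (1 / (p - q) * 0 / wt i)) (at_left T)"
    by (intro tendsto_intros lam_n_asymp inverse_product_asymp ratio_tendsto_0 u_ratio_tendsto i' wt)
  moreover have "\<forall>\<^sub>F t in at_left T. (T - t) * lam n t + (lam0 i - lam0 n) *
        ((T - t) / (u 1 t * u n t) * (u 1 t / u n t) / (u i t / u n t)) = (T - t) * lam i t"
    using ev_left
  proof eventually_elim
    case (elim t)
    have "lam i t = lam n t + (lam0 i - lam0 n) / (u n t * u i t)"
      using lam_diff[OF n1_mem(1) i', of t] elim by simp
    moreover have "(T - t) / (u 1 t * u n t) * (u 1 t / u n t) / (u i t / u n t) = (T - t) / (u n t * u i t)"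
      by (simp add: divide_simps)
    ultimately show ?case by (simp add: distrib_left mult.commute)
  qed
  ultimately show ?thesis using Lim_transform_eventually by fastforce
qed

lemma lam_eq_lam_1: "i \<in> {1..J} \<Longrightarrow> t \<in> {0..<T} \<Longrightarrow> lam i t = lam 1 t"
  using lam_diff[of 1 i t] lam0_low[of i] J by simp

lemma lam_asymp_low:
  assumes i: "i \<in> {1..J}"
  shows "((\<lambda>t. (T - t) * lam i t) \<longlongrightarrow> xi1) (at_left T)"
proof (rule Lim_transform_eventually[OF lam_1_asymp])
  show "\<forall>\<^sub>F t in at_left T. (T - t) * lam 1 t = (T - t) * lam i t"
    using ev_left by eventually_elim (simp add: lam_eq_lam_1[OF i])
qed

section \<open>The sum of the \<open>lam i\<close> and the limit of the scaled density\<close>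

lemma sum_split: "(\<Sum>i\<in>{1..n}. f i) = (\<Sum>i\<in>{1..J}. f i) + (\<Sum>i\<in>{J<..n}. f i)" for f :: "nat \<Rightarrow> real"
proof -
  have "{1..n} = {1..J} \<union> {J<..n}" using J by auto
  then show ?thesis by (simp add: sum.union_disjoint disjoint_iff)
qed

lemma sum_xi: "(\<Sum>i\<in>{1..n}. if i \<le> J then xi1 else xin) = gam"
  unfolding sum_split using J by (simp add: gam_def of_nat_diff)

lemma lam_sum_asymp: "((\<lambda>t. (T - t) * (\<Sum>i\<in>{1..n}. lam i t)) \<longlongrightarrow> gam) (at_left T)"
  unfolding sum_distrib_left sum_xi[symmetric]
  by (intro tendsto_sum) (use lam_asymp lam_asymp_low in auto)

text \<open>\<open>tendsto_if_primitive_converges\<close> is applied in logarithmic time. The limit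
  of the logarithmic derivative of the scaled density is \<open>- 2 - gam\<close>: it is 0 if
  \<open>xin > 0\<close>, where the logarithm converges, and nonpositive if \<open>xin = 0\<close>,
  where the logarithm tends to minus infinity.\<close>

lemma scaled_rho_limit:
  shows scaled_rho_tendsto: "((\<lambda>t. (T - t)\<^sup>2 * rho t) \<longlongrightarrow> real n / k * (xin\<^sup>2 + xin)) (at_left T)"
    and gam_eq: "xin > 0 \<Longrightarrow> gam = - 2"
    and gam_ge: "xin = 0 \<Longrightarrow> gam \<ge> - 2"
proof -
  \<comment> \<open>With \<open>x = - ln (T - t)\<close>, \<open>E x\<close> is the distance
    \<open>T - t\<close> and \<open>g x\<close> is the time \<open>t\<close>.\<close>
  define E where "E = (\<lambda>x::real. exp (- x))"
  define g where "g = (\<lambda>x. T - E x)"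
  define kn where "kn = k / real n"
  have kn: "kn > 0" using kpos n2 by (simp add: kn_def)
  have E_pos: "E x > 0" for x by (simp add: E_def)
  have g_lim: "filterlim g (at_left T) at_top"
    using filterlim_minus_exp_at_left[of T] by (simp add: g_def[abs_def] E_def)
  have ev: "\<forall>\<^sub>F x in at_top. 0 < g x \<and> g x < T"
    using eventually_compose_filterlim[OF ev_left g_lim] .
  have dE: "(E has_real_derivative - E x) (at x)" for x
    unfolding E_def by (auto intro!: derivative_eq_intros)
  have dg: "(g has_real_derivative E x) (at x)" for x
    using DERIV_diff[OF DERIV_const[of T] dE[of x]] by (simp add: g_def[abs_def])
  have E_lim: "(E \<longlongrightarrow> 0) at_top"
    unfolding E_def by (rule filterlim_compose[OF exp_at_bot filterlim_uminus_at_bot_at_top])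
  define S where "S = (\<lambda>x. \<Sum>i\<in>{1..n}. lam i (g x))"
  \<comment> \<open>In these variables \<open>m\<close> is \<open>(T - t) * lam 1\<close> and
    \<open>s\<close> is the scaled density; \<open>e\<close> collects all other terms of the
    derivative of \<open>m\<close> given by the Riccati equation, and \<open>l\<close> is the
    derivative of \<open>ln s\<close>.\<close>
  define m where "m = (\<lambda>x. E x * lam 1 (g x))"
  define s where "s = (\<lambda>x. kn * (E x * E x * rho (g x)))"
  define e where "e = (\<lambda>x. - m x - (m x)\<^sup>2 - kn * cb * (E x * E x))"
  define l where "l = (\<lambda>x. - 2 - E x * S x)"
  have m_lim: "(m \<longlongrightarrow> xi1) at_top"
    using filterlim_compose[OF lam_1_asymp g_lim] by (simp add: m_def g_def)
  have l_lim: "(l \<longlongrightarrow> - 2 - gam) at_top"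
  proof -
    have "((\<lambda>x. E x * S x) \<longlongrightarrow> gam) at_top"
      using filterlim_compose[OF lam_sum_asymp g_lim] by (simp add: S_def g_def)
    then show ?thesis unfolding l_def by (intro tendsto_intros)
  qed
  have e_lim: "(e \<longlongrightarrow> - xi1 - xi1\<^sup>2 - kn * cb * (0 * 0)) at_top"
    unfolding e_def by (intro tendsto_intros m_lim E_lim)
  have dm: "\<forall>\<^sub>F x in at_top. (m has_real_derivative e x + s x) (at x)"
    using ev
  proof eventually_elim
    case (elim x)
    then have "(lam 1 has_real_derivative - (lam 1 (g x))\<^sup>2 + kn * (rho (g x) - cb)) (at (g x))"
      using lam_within[OF n1_mem(2), of "g x"] at_within_T[of "g x"] by (simp add: kn_def)
    from DERIV_mult[OF dE DERIV_chain2[OF this dg]]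
    show ?case unfolding m_def
      by (rule DERIV_cong) (simp add: e_def s_def m_def algebra_simps power2_eq_square)
  qed
  have s_pos: "\<forall>\<^sub>F x in at_top. 0 < s x"
    using ev by eventually_elim (simp add: s_def kn E_pos rho_pos)
  have dln: "\<forall>\<^sub>F x in at_top. ((\<lambda>x. ln (s x)) has_real_derivative l x) (at x)"
    using ev s_pos
  proof eventually_elim
    case (elim x)
    then have "(rho has_real_derivative - rho (g x) * S x) (at (g x))"
      using rho_within[of "g x"] at_within_T[of "g x"] by (simp add: S_def)
    from DERIV_cmult[OF DERIV_mult[OF DERIV_mult[OF dE dE] DERIV_chain2[OF this dg]], of kn]
    have "(s has_real_derivative l x * s x) (at x)" unfolding s_def
      by (rule DERIV_cong) (simp add: l_def algebra_simps)
    from DERIV_chain2[OF DERIV_ln[OF elim(2)] this] show ?case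
      by (rule DERIV_cong) (use elim(2) in simp)
  qed
  have "\<forall>\<^sub>F x in at_top. \<bar>l x\<bar> < \<bar>- 2 - gam\<bar> + 1"
    using order_tendstoD(2)[OF tendsto_rabs[OF l_lim], of "\<bar>- 2 - gam\<bar> + 1"] by simp
  then have l_bd: "\<forall>\<^sub>F x in at_top. \<bar>l x\<bar> \<le> \<bar>- 2 - gam\<bar> + 1"
    by eventually_elim simp
  have "(s \<longlongrightarrow> - (- xi1 - xi1\<^sup>2 - kn * cb * (0 * 0))) at_top"
    by (rule tendsto_if_primitive_converges[OF m_lim e_lim dm s_pos dln l_bd])
  moreover have "- (- xi1 - xi1\<^sup>2 - kn * cb * (0 * 0)) = xin\<^sup>2 + xin"
    unfolding xi_simps(1) by (simp add: power2_eq_square algebra_simps)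
  ultimately have s_lim: "(s \<longlongrightarrow> xin\<^sup>2 + xin) at_top" by simp
  show "gam = - 2" if "xin > 0"
  proof -
    have "xin\<^sup>2 + xin > 0" using that by (simp add: add_pos_pos)
    then have "((\<lambda>x. ln (s x)) \<longlongrightarrow> ln (xin\<^sup>2 + xin)) at_top" by (intro tendsto_ln s_lim) auto
    from derivative_limit_zero_if_converges[OF this dln l_lim] show ?thesis by simp
  qed
  show "gam \<ge> - 2" if "xin = 0"
  proof -
    have "filterlim s (at_right 0) at_top"
      using s_lim s_pos that by (intro tendsto_imp_filterlim_at_right) auto
    then have "filterlim (\<lambda>x. ln (s x)) at_bot at_top" by (rule filterlim_compose[OF ln_at_0])
    from derivative_limit_nonpos_if_at_bot[OF this dln l_lim] show ?thesis by simp
  qed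
  have "((\<lambda>t. s (- ln (T - t))) \<longlongrightarrow> xin\<^sup>2 + xin) (at_left T)"
    by (rule filterlim_compose[OF s_lim filterlim_minus_ln_at_left])
  then have "((\<lambda>t. s (- ln (T - t)) / kn) \<longlongrightarrow> (xin\<^sup>2 + xin) / kn) (at_left T)"
    by (intro tendsto_divide tendsto_const) (use kn in auto)
  moreover have "\<forall>\<^sub>F t in at_left T. s (- ln (T - t)) / kn = (T - t)\<^sup>2 * rho t"
    using ev_left by eventually_elim (use kn in \<open>simp add: s_def g_def E_def power2_eq_square\<close>)
  ultimately have "((\<lambda>t. (T - t)\<^sup>2 * rho t) \<longlongrightarrow> (xin\<^sup>2 + xin) / kn) (at_left T)"
    by (rule Lim_transform_eventually)
  moreover have "(xin\<^sup>2 + xin) / kn = real n / k * (xin\<^sup>2 + xin)" by (simp add: kn_def)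
  ultimately show "((\<lambda>t. (T - t)\<^sup>2 * rho t) \<longlongrightarrow> real n / k * (xin\<^sup>2 + xin)) (at_left T)" by simp
qed

lemma gam_alt: "gam = - real J + (real n - 2 * real J) * xin"
  unfolding gam_def xi_simps(1) by (simp add: algebra_simps)

section \<open>The remainders \<open>R i\<close> and the integral of their sum\<close>

definition R where "R i t = lam i t - (if i \<le> J then xi1 else xin) / (T - t)"

lemma R_tendsto:
  assumes "i \<in> {1..n}"
  shows "((\<lambda>t. (T - t) * R i t) \<longlongrightarrow> 0) (at_left T)"
proof -
  define x where "x = (if i \<le> J then xi1 else xin)"
  have "((\<lambda>t. (T - t) * lam i t) \<longlongrightarrow> x) (at_left T)"
    using lam_asymp[of i] lam_asymp_low[of i] assms by (auto simp: x_def)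
  then have "((\<lambda>t. (T - t) * lam i t - x) \<longlongrightarrow> x - x) (at_left T)" by (intro tendsto_intros)
  then have "((\<lambda>t. (T - t) * lam i t - x) \<longlongrightarrow> 0) (at_left T)" by simp
  moreover have "\<forall>\<^sub>F t in at_left T. (T - t) * lam i t - x = (T - t) * R i t"
    using ev_left by eventually_elim (simp add: R_def x_def[symmetric] right_diff_distrib)
  ultimately show ?thesis by (rule Lim_transform_eventually)
qed

lemma sum_R: "(\<Sum>i\<in>{1..n}. R i t) = (\<Sum>i\<in>{1..n}. lam i t) - gam / (T - t)"
  unfolding R_def sum_subtractf sum_divide_distrib[symmetric] sum_xi ..

text \<open>For \<open>gam = - 2\<close> the sum of the remainders has the primitive
  \<open>\<Sum>i. I i t - 2 * ln (T - t)\<close>. Exponentiating and using \<open>rho_prod\<close>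
  identifies the integral with the scaled density, whose limit is known.\<close>

lemma exp_integral_R:
  assumes gam: "gam = - 2" and t: "t \<in> {0..<T}"
  shows "exp (- integral {0..t} (\<lambda>s. \<Sum>i\<in>{1..n}. R i s)) = (T - t)\<^sup>2 * rho t / (rho0 * T\<^sup>2)"
proof -
  define F where "F = (\<lambda>t. (\<Sum>i\<in>{1..n}. I i t) - 2 * ln (T - t))"
  have "((\<lambda>s. \<Sum>i\<in>{1..n}. R i s) has_integral F t - F 0) {0..t}"
  proof (rule fundamental_theorem_of_calculus)
    fix x assume "x \<in> {0..t}"
    then have x: "x \<in> {0..<T}" using t by auto
    have sub: "{0..t} \<subseteq> {0..<T}" using t by auto
    have "((\<lambda>t. 2 * ln (T - t)) has_real_derivative - 2 / (T - x)) (at x within {0..t})"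
      using x by (auto intro!: derivative_eq_intros)
    moreover have "((\<lambda>t. \<Sum>i\<in>{1..n}. I i t) has_real_derivative (\<Sum>i\<in>{1..n}. lam i x)) (at x within {0..t})"
      by (rule DERIV_subset[OF _ sub]) (intro DERIV_sum I_within x)
    ultimately have "(F has_real_derivative (\<Sum>i\<in>{1..n}. lam i x) - - 2 / (T - x)) (at x within {0..t})"
      unfolding F_def by (intro DERIV_diff)
    then show "(F has_vector_derivative (\<Sum>i\<in>{1..n}. R i x)) (at x within {0..t})"
      by (simp add: sum_R gam has_real_derivative_iff_has_vector_derivative)
  qed (use t in simp)
  then have "integral {0..t} (\<lambda>s. \<Sum>i\<in>{1..n}. R i s) = (\<Sum>i\<in>{1..n}. I i t) - 2 * ln (T - t) + 2 * ln T"
    by (simp add: integral_unique F_def)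
  then have "- integral {0..t} (\<lambda>s. \<Sum>i\<in>{1..n}. R i s) =
      2 * ln (T - t) - ((\<Sum>i\<in>{1..n}. I i t) + 2 * ln T)" by simp
  then have "exp (- integral {0..t} (\<lambda>s. \<Sum>i\<in>{1..n}. R i s))
      = exp (2 * ln (T - t)) / (exp (\<Sum>i\<in>{1..n}. I i t) * exp (2 * ln T))"
    by (simp only: exp_diff exp_add)
  also have "exp (2 * ln (T - t)) = (T - t)\<^sup>2" using t by (simp add: exp_double)
  also have "exp (2 * ln T) = T\<^sup>2" using T_pos by (simp add: exp_double)
  also have "exp (\<Sum>i\<in>{1..n}. I i t) = rho0 / rho t"
    using rho_prod[OF t] rho_pos[OF t] by (simp add: exp_sum u_eq_exp field_simps)
  finally show ?thesis using rho_pos[OF t] by (simp add: field_simps)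
qed

lemma exp_integral_R_tendsto:
  assumes gam: "gam = - 2"
  shows "((\<lambda>t. exp (- integral {0..t} (\<lambda>s. \<Sum>i\<in>{1..n}. R i s))) \<longlongrightarrow>
     real n / k * (xin\<^sup>2 + xin) / (rho0 * T\<^sup>2)) (at_left T)"
proof (rule Lim_transform_eventually)
  show "((\<lambda>t. (T - t)\<^sup>2 * rho t / (rho0 * T\<^sup>2)) \<longlongrightarrow> real n / k * (xin\<^sup>2 + xin) / (rho0 * T\<^sup>2)) (at_left T)"
    by (intro tendsto_divide scaled_rho_tendsto tendsto_const) (use rho0pos T_pos in simp)
  show "\<forall>\<^sub>F t in at_left T. (T - t)\<^sup>2 * rho t / (rho0 * T\<^sup>2) =
      exp (- integral {0..t} (\<lambda>s. \<Sum>i\<in>{1..n}. R i s))"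
    using ev_left by eventually_elim (simp add: exp_integral_R[OF gam])
qed

lemma integral_R_at_top:
  assumes gam: "gam = - 2" and xin: "xin = 0"
  shows "filterlim (\<lambda>t. integral {0..t} (\<lambda>s. \<Sum>i\<in>{1..n}. R i s)) at_top (at_left T)"
proof -
  have "filterlim (\<lambda>t. exp (- integral {0..t} (\<lambda>s. \<Sum>i\<in>{1..n}. R i s))) (at_right 0) (at_left T)"
    using exp_integral_R_tendsto[OF gam] xin by (intro tendsto_imp_filterlim_at_right) auto
  then have "filterlim (\<lambda>t. ln (exp (- integral {0..t} (\<lambda>s. \<Sum>i\<in>{1..n}. R i s)))) at_bot (at_left T)"
    by (rule filterlim_compose[OF ln_at_0])
  then show ?thesis unfolding ln_exp by (simp only: filterlim_uminus_at_top)
qed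

text \<open>As \<open>rho\<close> is positive, the second derivative
  \<open>k / n * (rho - cb) * u i\<close> is at least \<open>- K * u i\<close> with
  \<open>K = k * cb / n\<close>, so \<open>supersolution_bounded_below\<close> applies.\<close>

lemma u_bounded_below:
  assumes i: "i \<in> {J<..n}"
  obtains c C where "c > 0" "\<forall>\<^sub>F t in at_left T. u i t \<ge> c \<and> lam i t \<ge> - C"
proof -
  have i': "i \<in> {1..n}" using i by auto
  define K where "K = k * cb / real n"
  have K: "K > 0" using kpos cbpos n2 by (simp add: K_def)
  obtain c C where c: "c > 0" "\<forall>\<^sub>F t in at_left T. u i t \<ge> c \<and> lam i t * u i t \<ge> - C * u i t"
  proof (rule supersolution_bounded_below[OF T_pos K])
    fix t assume t: "0 < t" "t < T"
    then have du: "(u i has_real_derivative lam i t * u i t) (at t)"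
      using u_within[OF i', of t] at_within_T[of t] by simp
    then show "(u i has_real_derivative lam i t * u i t) (at t)" .
    have dl: "(lam i has_real_derivative - (lam i t)\<^sup>2 + k / real n * (rho t - cb)) (at t)"
      using lam_within[OF i', of t] at_within_T[of t] t by simp
    show "((\<lambda>t. lam i t * u i t) has_real_derivative k / real n * (rho t - cb) * u i t) (at t)"
      using DERIV_mult[OF dl du] by (rule DERIV_cong) (simp add: algebra_simps power2_eq_square)
    have "0 \<le> k / real n * rho t * u i t" using kpos rho_pos[of t] t by (simp add: less_imp_le)
    then show "- K * u i t \<le> k / real n * (rho t - cb) * u i t" by (simp add: K_def algebra_simps diff_divide_distrib)
    show "0 < u i t" by simp
  qed (rule u_over_dist_at_top[OF i])
  from c(2) have "\<forall>\<^sub>F t in at_left T. u i t \<ge> c \<and> lam i t \<ge> - C"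
    by eventually_elim (metis mult_right_le_imp_le u_pos)
  with c(1) show ?thesis by (rule that)
qed

lemma rho_bigo: "rho \<in> O[at_left T](\<lambda>t. 1 / (T - t)\<^sup>2)"
proof -
  have "(\<lambda>t. (T - t)\<^sup>2 * rho t / 1) \<in> O[at_left T](\<lambda>t. 1)"
    using scaled_rho_tendsto by (intro bigoI_tendsto[of _ _ "real n / k * (xin\<^sup>2 + xin)"]) simp_all
  then have "(\<lambda>t. 1 / (T - t)\<^sup>2 * ((T - t)\<^sup>2 * rho t)) \<in> O[at_left T](\<lambda>t. 1 / (T - t)\<^sup>2 * 1)"
    by (intro landau_o.big.mult) simp_all
  moreover have "\<forall>\<^sub>F t in at_left T. 1 / (T - t)\<^sup>2 * ((T - t)\<^sup>2 * rho t) = rho t"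
    using ev_left by eventually_elim simp
  ultimately show ?thesis using landau_o.big.in_cong by force
qed

lemma rho_smallo:
  assumes "xin = 0"
  shows "rho \<in> o[at_left T](\<lambda>t. 1 / (T - t)\<^sup>2)"
proof (rule smalloI_tendsto)
  show "((\<lambda>t. rho t / (1 / (T - t)\<^sup>2)) \<longlongrightarrow> 0) (at_left T)"
    using scaled_rho_tendsto assms by (simp add: mult.commute)
  show "\<forall>\<^sub>F t in at_left T. 1 / (T - t)\<^sup>2 \<noteq> 0" using ev_left by eventually_elim simp
qed

section \<open>The individual cases\<close>

text \<open>Only the factor \<open>u 1\<close> of the product of the \<open>u i\<close> degenerates:
  \<open>u 1 * u n\<close> is comparable to \<open>T - t\<close>, and the remaining factors stay
  away from 0. Thus \<open>rho\<close> is at most of order \<open>1 / (T - t)\<close>, and since the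
  derivative of \<open>lam i\<close> is at most \<open>k / n * rho\<close>, integration gives
  logarithmic growth.\<close>

lemma case_1_asymptotics:
  assumes J1: "J = 1"
  shows rho_bigo_inverse: "rho \<in> O[at_left T](\<lambda>t. 1 / (T - t))"
    and lam_bigo_ln: "i \<in> {2..n} \<Longrightarrow> lam i \<in> O[at_left T](\<lambda>t. ln (T - t))"
proof -
  have mem: "i \<in> {J<..n}" if "i \<in> {2..n}" for i using that J1 by auto
  have "\<exists>c > 0. \<forall>\<^sub>F t in at_left T. c \<le> u i t" if i: "i \<in> {2..n}" for i
  proof -
    obtain c C where c: "c > 0" "\<forall>\<^sub>F t in at_left T. u i t \<ge> c \<and> lam i t \<ge> - C"
      using u_bounded_below[OF mem[OF i]] .
    from c(2) have "\<forall>\<^sub>F t in at_left T. c \<le> u i t" by eventually_elim simp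
    with c(1) show ?thesis by blast
  qed
  then obtain c where c: "\<And>i. i \<in> {2..n} \<Longrightarrow> c i > 0"
      "\<And>i. i \<in> {2..n} \<Longrightarrow> \<forall>\<^sub>F t in at_left T. c i \<le> u i t" by metis
  define P where "P = (\<Prod>i\<in>{2..<n}. c i)"
  have P: "P > 0" unfolding P_def using c(1) by (intro prod_pos) auto
  have set_eq: "{1..n} = insert 1 (insert n {2..<n})" using n2 by auto
  \<comment> \<open>Half of the limit \<open>p - q\<close> bounds \<open>u 1 * u n / (T - t)\<close>
    from below near \<open>T\<close>; \<open>P\<close> bounds the other factors and equals 1 when
    \<open>n = 2\<close>.\<close>
  define B where "B = rho0 / ((p - q) / 2 * P)"
  have "\<forall>\<^sub>F t in at_left T. \<forall>i\<in>{2..<n}. c i \<le> u i t"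
    using c(2) by (intro eventually_ball_finite) auto
  moreover have "\<forall>\<^sub>F t in at_left T. (p - q) / 2 < u 1 t * u n t / (T - t)"
    using order_tendstoD(1)[OF product_asymp, of "(p - q) / 2"] pq by simp
  ultimately have rho_le: "\<forall>\<^sub>F t in at_left T. rho t \<le> B / (T - t)"
    using ev_left
  proof eventually_elim
    case (elim t)
    have "(p - q) / 2 * (T - t) \<le> u 1 t * u n t" using elim by (simp add: field_simps)
    moreover have "P \<le> (\<Prod>i\<in>{2..<n}. u i t)" unfolding P_def using elim(1) c(1)
      by (intro prod_mono) (auto intro: less_imp_le)
    ultimately have "(p - q) / 2 * (T - t) * P \<le> u 1 t * u n t * (\<Prod>i\<in>{2..<n}. u i t)"
      by (rule mult_mono) (use P in \<open>auto intro: less_imp_le\<close>)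
    also have "\<dots> = (\<Prod>i\<in>{1..n}. u i t)" unfolding set_eq using n2 by simp
    finally have "rho0 / (\<Prod>i\<in>{1..n}. u i t) \<le> rho0 / ((p - q) / 2 * (T - t) * P)"
      using P pq elim rho0pos by (intro divide_left_mono) (auto intro!: mult_pos_pos prod_pos)
    then show ?case using elim rho_eq[of t] by (simp add: B_def mult_ac)
  qed
  show "rho \<in> O[at_left T](\<lambda>t. 1 / (T - t))"
  proof (rule bigoI[of _ B])
    show "\<forall>\<^sub>F t in at_left T. norm (rho t) \<le> B * norm (1 / (T - t))"
      using rho_le ev_left
    proof eventually_elim
      case (elim t)
      then show ?case using rho_pos[of t] by simp
    qed
  qed
  assume i: "i \<in> {2..n}"
  then have i': "i \<in> {1..n}" by auto
  obtain c C where C: "c > 0" "\<forall>\<^sub>F t in at_left T. u i t \<ge> c \<and> lam i t \<ge> - C"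
    using u_bounded_below[OF mem[OF i]] .
  show "lam i \<in> O[at_left T](\<lambda>t. ln (T - t))"
  proof (rule bigo_ln_if_derivative_bounded)
    show "\<forall>\<^sub>F t in at_left T. - C \<le> lam i t" using C(2) by eventually_elim simp
    show "\<forall>\<^sub>F t in at_left T. (lam i has_real_derivative - (lam i t)\<^sup>2 + k / real n * (rho t - cb)) (at t)"
      using ev_left
    proof eventually_elim
      case (elim t)
      then show ?case using lam_within[OF i', of t] at_within_T[of t] by simp
    qed
    show "\<forall>\<^sub>F t in at_left T. - (lam i t)\<^sup>2 + k / real n * (rho t - cb) \<le> k / real n * B / (T - t)"
      using rho_le
    proof eventually_elim
      case (elim t)
      have "k / real n * (rho t - cb) \<le> k / real n * (B / (T - t))"
        using elim kpos cbpos by (intro mult_left_mono) auto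
      moreover have "0 \<le> (lam i t)\<^sup>2" by simp
      moreover have "k / real n * B / (T - t) = k / real n * (B / (T - t))" by simp
      ultimately show ?case by linarith
    qed
  qed
qed

text \<open>Since \<open>u 2 = u 1\<close>, the formula for \<open>rho\<close> contains
  \<open>(u 1)\<^sup>2\<close>. Pairing it with \<open>(u n)\<^sup>2\<close> isolates on the right a
  quantity with a positive limit, so the scaled density determines the growth of the remaining
  factors, which behave like a multiple of \<open>u n ^ (n - 4)\<close> when
  \<open>n \<ge> 4\<close>.\<close>

lemma scaled_rho_J2:
  assumes J2: "J = 2" and t: "0 < t" "t < T"
  shows "(T - t)\<^sup>2 * rho t * ((\<Prod>i\<in>{3..n}. u i t) / (u n t)\<^sup>2) = rho0 * ((T - t) / (u 1 t * u n t))\<^sup>2"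
proof -
  have set_eq: "{1..n} = insert 1 (insert 2 {3..n})" using J2 J_less by auto
  have "lam 2 s = lam 1 s" if "s \<in> {0..<T}" for s using lam_eq_lam_1[of 2 s] that J2 by simp
  then have "I 2 t = I 1 t" unfolding I_def using t by (intro integral_cong) auto
  then have "u 2 t = u 1 t" by (simp add: u_eq_exp)
  then have "rho t * (u 1 t * u 1 t * (\<Prod>i\<in>{3..n}. u i t)) = rho0"
    using rho_prod[of t] t unfolding set_eq by (simp add: mult.assoc)
  then have "rho0 * ((T - t) / (u 1 t * u n t))\<^sup>2 =
      rho t * (u 1 t * u 1 t * (\<Prod>i\<in>{3..n}. u i t)) * ((T - t) / (u 1 t * u n t))\<^sup>2" by simp
  also have "\<dots> = (T - t)\<^sup>2 * rho t * ((\<Prod>i\<in>{3..n}. u i t) / (u n t)\<^sup>2)"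
    by (simp add: power2_eq_square divide_simps)
  finally show ?thesis by simp
qed

text \<open>The scaled density tends to 0, so \<open>scaled_rho_J2\<close> forces
  \<open>u n ^ (n - 2) / (u n)\<^sup>2\<close> to infinity. With \<open>u n\<close> bounded away
  from 0 this excludes \<open>n = 3\<close> and \<open>n = 4\<close>, and then makes
  \<open>u n\<close>, and with it every \<open>u i\<close> of index at least 3, diverge.\<close>

lemma case_2a_growth:
  assumes J2: "J = 2" and xin: "xin = 0"
  shows n_ge_5: "n \<ge> 5"
    and I_at_top: "i \<in> {3..n} \<Longrightarrow> filterlim (I i) at_top (at_left T)"
proof -
  have n3: "n \<ge> 3" using J2 J_less by simp
  have card_3n: "card {3..n} = n - 2" using n3 by simp
  have nmem: "n \<in> {J<..n}" using J_less by simp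
  have sr0: "filterlim (\<lambda>t. (T - t)\<^sup>2 * rho t) (at_right 0) (at_left T)"
  proof (rule tendsto_imp_filterlim_at_right)
    show "((\<lambda>t. (T - t)\<^sup>2 * rho t) \<longlongrightarrow> 0) (at_left T)" using scaled_rho_tendsto xin by simp
    show "\<forall>\<^sub>F t in at_left T. 0 < (T - t)\<^sup>2 * rho t"
      using ev_left by eventually_elim (simp add: rho_pos)
  qed
  have "((\<lambda>t. rho0 * ((T - t) / (u 1 t * u n t))\<^sup>2) \<longlongrightarrow> rho0 * (1 / (p - q))\<^sup>2) (at_left T)"
    by (intro tendsto_intros inverse_product_asymp)
  moreover have "((\<lambda>t. \<Prod>i\<in>{3..n}. u i t / u n t) \<longlongrightarrow> (\<Prod>i\<in>{3..n}. wt i)) (at_left T)"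
    by (intro tendsto_prod u_ratio_tendsto) auto
  moreover have wts: "(\<Prod>i\<in>{3..n}. wt i) > 0" using J2 by (intro prod_pos ballI wt_pos) auto
  moreover have "(\<Prod>i\<in>{3..n}. wt i) \<noteq> 0" using wts by (rule less_imp_neq[THEN not_sym])
  ultimately have "((\<lambda>t. rho0 * ((T - t) / (u 1 t * u n t))\<^sup>2 / (\<Prod>i\<in>{3..n}. u i t / u n t))
      \<longlongrightarrow> rho0 * (1 / (p - q))\<^sup>2 / (\<Prod>i\<in>{3..n}. wt i)) (at_left T)"
    by (intro tendsto_divide)
  moreover have "rho0 * (1 / (p - q))\<^sup>2 / (\<Prod>i\<in>{3..n}. wt i) > 0"
    using wts rho0pos pq by simp
  moreover have "filterlim (\<lambda>t. inverse ((T - t)\<^sup>2 * rho t)) at_top (at_left T)"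
    by (rule filterlim_compose[OF filterlim_inverse_at_top_right sr0])
  ultimately have "filterlim (\<lambda>t. rho0 * ((T - t) / (u 1 t * u n t))\<^sup>2 / (\<Prod>i\<in>{3..n}. u i t / u n t)
      * inverse ((T - t)\<^sup>2 * rho t)) at_top (at_left T)"
    by (rule filterlim_tendsto_pos_mult_at_top)
  moreover have "\<forall>\<^sub>F t in at_left T. rho0 * ((T - t) / (u 1 t * u n t))\<^sup>2 / (\<Prod>i\<in>{3..n}. u i t / u n t)
      * inverse ((T - t)\<^sup>2 * rho t) = u n t ^ (n - 2) / (u n t)\<^sup>2"
    using ev_left
  proof eventually_elim
    case (elim t)
    have "(\<Prod>i\<in>{3..n}. u i t / u n t) = (\<Prod>i\<in>{3..n}. u i t) / u n t ^ (n - 2)"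
      unfolding prod_dividef prod_constant card_3n ..
    moreover have "(T - t)\<^sup>2 * rho t \<noteq> 0" using elim rho_pos[of t] by simp
    moreover have "(\<Prod>i\<in>{3..n}. u i t) \<noteq> 0" by simp
    ultimately show ?case
      using scaled_rho_J2[OF J2, of t, symmetric] elim by (simp add: field_simps)
  qed
  ultimately have big: "filterlim (\<lambda>t. u n t ^ (n - 2) / (u n t)\<^sup>2) at_top (at_left T)"
    by (rule filterlim_cong[OF refl refl, THEN iffD1, rotated])
  obtain c C where c: "c > 0" "\<forall>\<^sub>F t in at_left T. u n t \<ge> c \<and> lam n t \<ge> - C"
    using u_bounded_below[OF nmem] .
  show n5: "n \<ge> 5"
  proof (rule ccontr)
    assume "\<not> n \<ge> 5"
    then have "n = 3 \<or> n = 4" using n3 by auto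
    \<comment> \<open>The bound exceeds both possible values of the quotient: it is 1 for
      \<open>n = 4\<close> and \<open>1 / u n \<le> 1 / c\<close> for \<open>n = 3\<close>.\<close>
    have "\<forall>\<^sub>F t in at_left T. max 1 (1 / c) + 1 \<le> u n t ^ (n - 2) / (u n t)\<^sup>2"
      using big unfolding filterlim_at_top by blast
    with c(2) have "\<forall>\<^sub>F t in at_left T. False"
    proof eventually_elim
      case (elim t)
      have "1 / u n t \<le> 1 / c" using elim c(1) by (intro divide_left_mono) auto
      then show ?case using \<open>n = 3 \<or> n = 4\<close> elim by (auto simp: power2_eq_square)
    qed
    then show False by simp
  qed
  have un: "filterlim (u n) at_top (at_left T)"
    unfolding filterlim_at_top
  proof
    fix Z
    \<comment> \<open>The quotient equals \<open>u n ^ (n - 4)\<close> with a positive exponent, so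
      exceeding this threshold means \<open>u n > \<bar>Z\<bar>\<close>.\<close>
    have "\<forall>\<^sub>F t in at_left T. \<bar>Z\<bar> ^ (n - 4) + 1 \<le> u n t ^ (n - 2) / (u n t)\<^sup>2"
      using big unfolding filterlim_at_top by blast
    then show "\<forall>\<^sub>F t in at_left T. Z \<le> u n t"
    proof eventually_elim
      case (elim t)
      have "n - 2 = (n - 4) + 2" using n5 by simp
      then have "u n t ^ (n - 2) = u n t ^ (n - 4) * (u n t)\<^sup>2"
        by (simp only: power_add)
      then have "\<bar>Z\<bar> ^ (n - 4) < u n t ^ (n - 4)" using elim by simp
      then have "\<bar>Z\<bar> < u n t" by (rule power_less_imp_less_base) (simp add: less_imp_le)
      then show ?case by simp
    qed
  qed
  assume i: "i \<in> {3..n}"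
  have "filterlim (\<lambda>t. u i t / u n t * u n t) at_top (at_left T)"
    by (rule filterlim_tendsto_pos_mult_at_top[OF u_ratio_tendsto wt_pos un]) (use i J2 in auto)
  then have "filterlim (\<lambda>t. ln (u i t)) at_top (at_left T)"
    by (intro filterlim_compose[OF ln_at_top]) simp
  then show "filterlim (I i) at_top (at_left T)" by (simp add: u_eq_exp)
qed

text \<open>For \<open>n = 4\<close> the limit of the scaled density can also be computed from
  \<open>scaled_rho_J2\<close>. Equating both values gives
  \<open>k * rho0 = wt 3 * (p - q)\<^sup>2 * 4 * (xin\<^sup>2 + xin)\<close>, while
  \<open>A = wt 3 * (p - q)\<^sup>2 * (1 + 2 * xin)\<^sup>2\<close>; their difference is
  \<open>wt 3 * (p - q)\<^sup>2\<close>.\<close>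

lemma case_2b_constants:
  assumes J2: "J = 2" and n4: "n = 4"
  defines "A \<equiv> (lam0 1 - lam0 3) * (lam0 1 - lam0 4)"
  shows A_gt: "A > k * rho0" and sqrt_A: "sqrt (A / (A - k * rho0)) = 1 + 2 * xin"
proof -
  have wt3: "wt 3 > 0" using J2 n4 by (intro wt_pos) auto
  have "((\<lambda>t. rho0 * ((T - t) / (u 1 t * u n t))\<^sup>2 / (u 3 t / u n t)) \<longlongrightarrow>
      rho0 * (1 / (p - q))\<^sup>2 / wt 3) (at_left T)"
    by (intro tendsto_intros inverse_product_asymp u_ratio_tendsto) (use wt3 n4 in auto)
  moreover have "\<forall>\<^sub>F t in at_left T. rho0 * ((T - t) / (u 1 t * u n t))\<^sup>2 / (u 3 t / u n t) = (T - t)\<^sup>2 * rho t"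
    using ev_left
  proof eventually_elim
    case (elim t)
    have "{3..n} = {3, 4}" using n4 by auto
    then have "(\<Prod>i\<in>{3..n}. u i t) / (u n t)\<^sup>2 = u 3 t / u n t" using n4 by (simp add: power2_eq_square)
    then show ?case using scaled_rho_J2[OF J2, of t, symmetric] elim by simp
  qed
  ultimately have "((\<lambda>t. (T - t)\<^sup>2 * rho t) \<longlongrightarrow> rho0 * (1 / (p - q))\<^sup>2 / wt 3) (at_left T)"
    by (rule Lim_transform_eventually)
  from tendsto_unique[OF left_ne this scaled_rho_tendsto]
  have eq: "rho0 * (1 / (p - q))\<^sup>2 / wt 3 = 4 / k * (xin\<^sup>2 + xin)" using n4 by simp
  define y where "y = (1 + 2 * xin)\<^sup>2"
  have y: "y > 0" using xi_simps(2) by (simp add: y_def)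
  have gap: "lam0 4 - lam0 1 = (p - q) * (1 + 2 * xin)"
    using gap_eq n4 pq by (simp add: xin_def field_simps)
  have gap0: "lam0 4 - lam0 1 > 0" using gap_pos n4 by simp
  have A_eq: "A = wt 3 * ((p - q) * (1 + 2 * xin))\<^sup>2"
  proof -
    have "lam0 n = lam0 4" by (simp only: n4)
    then have "wt 3 * (lam0 4 - lam0 1) = lam0 3 - lam0 1" using gap0 by (simp add: wt_def)
    then have "wt 3 * (lam0 4 - lam0 1)\<^sup>2 = (lam0 3 - lam0 1) * (lam0 4 - lam0 1)"
      by (simp add: power2_eq_square mult.assoc[symmetric])
    then show ?thesis unfolding gap[symmetric] by (simp add: A_def algebra_simps)
  qed
  then have A_y: "A = wt 3 * (p - q)\<^sup>2 * y" by (simp add: y_def power_mult_distrib)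
  have A_pos: "A > 0" unfolding A_y using wt3 pq y by simp
  have "k * rho0 = wt 3 * (p - q)\<^sup>2 * (4 * (xin\<^sup>2 + xin))"
    using eq wt3 pq kpos by (simp add: field_simps)
  also have "4 * (xin\<^sup>2 + xin) = y - 1" by (simp add: y_def power2_eq_square algebra_simps)
  finally have krho: "A - k * rho0 = wt 3 * (p - q)\<^sup>2" by (simp add: A_y algebra_simps)
  have pos: "wt 3 * (p - q)\<^sup>2 > 0" using wt3 pq by simp
  then show "A > k * rho0" using krho by simp
  have "A / (A - k * rho0) = y" unfolding krho unfolding A_y using wt3 pq by simp
  then show "sqrt (A / (A - k * rho0)) = 1 + 2 * xin" using xi_simps(2) by (simp add: y_def)
qed

section \<open>The quadratic equation and the possible values of \<open>J\<close> and
  \<open>n\<close>\<close>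

lemma xi_roots: "(\<forall>\<xi>\<in>{xi1, xin}. \<xi>\<^sup>2 + \<xi> - c = 0) \<longleftrightarrow> xin\<^sup>2 + xin = c"
  unfolding xi_simps(1) by (auto simp: power2_eq_square algebra_simps)

lemma xi_roots_0: "(\<forall>\<xi>\<in>{xi1, xin}. \<xi>\<^sup>2 + \<xi> = 0) \<longleftrightarrow> xin = 0"
proof -
  have "xin\<^sup>2 + xin = 0 \<longleftrightarrow> xin = 0"
    using xi_simps(2) by (auto simp: add_nonneg_eq_0_iff)
  then show ?thesis using xi_roots[of 0] by simp
qed

text \<open>Insert \<open>gam = - J + (n - 2 * J) * xin\<close>. For \<open>xin = 0\<close> the
  bound \<open>gam \<ge> - 2\<close> gives \<open>J \<le> 2\<close>. For \<open>xin > 0\<close> the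
  equation \<open>(n - 2 * J) * xin = J - 2\<close> has the wrong sign if \<open>J = 1\<close>,
  forces \<open>n = 4\<close> if \<open>J = 2\<close>, and forces \<open>n > 2 * J\<close> if
  \<open>J \<ge> 3\<close>.\<close>

lemma classification:
  "J = 1 \<and> xin = 0 \<or> J = 2 \<and> xin = 0 \<and> gam = - 2 \<or> J = 2 \<and> n = 4 \<and> xin > 0 \<and> gam = - 2
   \<or> J \<ge> 3 \<and> n > 2 * J \<and> xin > 0 \<and> gam = - 2"
proof (cases "xin = 0")
  case True
  then have "gam = - real J" using gam_alt by simp
  moreover from this have "J \<le> 2" using gam_ge[OF True] by simp
  ultimately have "J = 1 \<or> J = 2 \<and> gam = - 2" using J by auto
  then show ?thesis using True by blast
next
  case False
  then have x: "xin > 0" using xi_simps(2) by simp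
  then have g: "gam = - 2" by (rule gam_eq)
  have eq: "(real n - 2 * real J) * xin = real J - 2" using gam_alt g by linarith
  consider "J = 1" | "J = 2" | "J \<ge> 3" using J by linarith
  then show ?thesis
  proof cases
    case 1
    then have "(real n - 2) * xin = - 1" using eq by simp
    moreover have "(real n - 2) * xin \<ge> 0" using n2 x by simp
    ultimately show ?thesis by simp
  next
    case 2
    then have "(real n - 4) * xin = 0" using eq by simp
    then have "n = 4" using x by simp
    then show ?thesis using 2 x g by blast
  next
    case 3
    then have "(real n - 2 * real J) * xin > 0" using eq by simp
    then have "real n > 2 * real J" using x by (simp add: zero_less_mult_iff)
    then have "n > 2 * J" by linarith
    then show ?thesis using 3 x g by blast
  qed
qed

lemma exp_integral_R_limit:
  assumes gam: "gam = - 2" and x: "xin > 0"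
  shows "\<exists>R0 > 0. ((\<lambda>t. exp (- integral {0..t} (\<lambda>s. \<Sum>i\<in>{1..n}. R i s))) \<longlongrightarrow> R0) (at_left T) \<and>
     (\<forall>\<xi>\<in>{xi1, xin}. \<xi>\<^sup>2 + \<xi> - k * rho0 * T\<^sup>2 * R0 / real n = 0)"
proof (intro exI conjI)
  define R0 where "R0 = real n / k * (xin\<^sup>2 + xin) / (rho0 * T\<^sup>2)"
  show "((\<lambda>t. exp (- integral {0..t} (\<lambda>s. \<Sum>i\<in>{1..n}. R i s))) \<longlongrightarrow> R0) (at_left T)"
    unfolding R0_def by (rule exp_integral_R_tendsto[OF gam])
  show "R0 > 0" unfolding R0_def using n2 kpos rho0pos T_pos x
    by (intro divide_pos_pos mult_pos_pos add_pos_pos) auto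
  show "\<forall>\<xi>\<in>{xi1, xin}. \<xi>\<^sup>2 + \<xi> - k * rho0 * T\<^sup>2 * R0 / real n = 0"
    unfolding xi_roots R0_def using n2 kpos rho0pos T_pos by simp
qed

end

section \<open>Blow-up profile and rates in each case of the classification\<close>

theorem theorem4p2:
  fixes n J :: nat and k cb rho0 tB p q xi1 xin :: real
    and lam0 :: "nat \<Rightarrow> real" and lam :: "nat \<Rightarrow> real \<Rightarrow> real" and rho :: "real \<Rightarrow> real"
  assumes n2: "n \<ge> 2" and kpos: "k > 0" and cbpos: "cb > 0" and rho0pos: "rho0 > 0"
    and J: "1 \<le> J" "J \<le> n"
    and init_eq: "\<forall>i\<in>{1..J}. lam0 i = lam0 1"
    and init_gap: "J < n \<longrightarrow> lam0 J < lam0 (J + 1)"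
    and init_mono: "\<forall>i j. J + 1 \<le> i \<and> i \<le> j \<and> j \<le> n \<longrightarrow> lam0 i \<le> lam0 j"
    and maxsol: "maximal_solution n k cb rho0 lam0 tB lam rho"
    and tB: "0 < tB"
    and lim_p: "((\<lambda>t. deriv (uu lam 1) t * uu lam n t) \<longlongrightarrow> - p) (at_left tB)"
    and lim_q: "((\<lambda>t. uu lam 1 t * deriv (uu lam n) t) \<longlongrightarrow> q) (at_left tB)"
    and q_nonneg: "0 \<le> q"
    and pq: "p > q"
    and xi1_def: "xi1 = - p / (p - q)"
    and xin_def: "xin = q / (p - q)"
  shows "\<exists>R :: nat \<Rightarrow> real \<Rightarrow> real.
    (\<forall>i\<in>{1..n}. ((\<lambda>t. (tB - t) * R i t) \<longlongrightarrow> 0) (at_left tB)) \<and>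
    (\<forall>i\<in>{1..J}. \<forall>t\<in>{0..<tB}. R i t = R 1 t) \<and>
    (\<forall>i\<in>{1..J}. \<forall>t\<in>{0..<tB}. lam i t = xi1 / (tB - t) + R i t) \<and>
    (\<forall>i\<in>{J<..n}. \<forall>t\<in>{0..<tB}. lam i t = xin / (tB - t) + R i t) \<and>
    (\<forall>t\<in>{0..<tB}. (\<Sum>i\<in>{1..n}. lam i t) =
        ((- p * real J + q * (real n - real J)) / (p - q)) / (tB - t)
        + (\<Sum>i\<in>{1..n}. R i t)) \<and>
    (let Rs = (\<lambda>s. \<Sum>i\<in>{1..n}. R i s);
         case1 = (J = 1 \<and> (\<forall>\<xi>\<in>{xi1, xin}. \<xi>\<^sup>2 + \<xi> = 0));
         case2a = (J = 2 \<and> filterlim (\<lambda>t. integral {0..t} Rs) at_top (at_left tB)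
                   \<and> (\<forall>\<xi>\<in>{xi1, xin}. \<xi>\<^sup>2 + \<xi> = 0));
         case2b = (J = 2 \<and> n = 4 \<and> (\<exists>R0 > 0.
                   ((\<lambda>t. exp (- integral {0..t} Rs)) \<longlongrightarrow> R0) (at_left tB) \<and>
                   (\<forall>\<xi>\<in>{xi1, xin}. \<xi>\<^sup>2 + \<xi> - k * rho0 * tB\<^sup>2 * R0 / 4 = 0)));
         case3 = (J \<ge> 3 \<and> n > 2 * J \<and> (\<exists>R0 > 0.
                   ((\<lambda>t. exp (- integral {0..t} Rs)) \<longlongrightarrow> R0) (at_left tB) \<and>
                   (\<forall>\<xi>\<in>{xi1, xin}. \<xi>\<^sup>2 + \<xi> - k * rho0 * tB\<^sup>2 * R0 / real n = 0)));
         A0 = (lam0 1 - lam0 3) * (lam0 1 - lam0 4)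
     in (case1 \<or> case2a \<or> case2b \<or> case3) \<and>
        (case1 \<longrightarrow>
           ((\<lambda>t. (tB - t) * lam 1 t) \<longlongrightarrow> -1) (at_left tB) \<and>
           (\<forall>i\<in>{2..n}. lam i \<in> O[at_left tB](\<lambda>t. ln (tB - t))) \<and>
           rho \<in> O[at_left tB](\<lambda>t. 1 / (tB - t))) \<and>
        (case2a \<longrightarrow>
           n \<ge> 5 \<and>
           ((\<lambda>t. (tB - t) * lam 1 t) \<longlongrightarrow> -1) (at_left tB) \<and>
           (\<forall>i\<in>{3..n}. ((\<lambda>t. (tB - t) * lam i t) \<longlongrightarrow> 0) (at_left tB) \<and>
               filterlim (\<lambda>t. integral {0..t} (lam i)) at_top (at_left tB)) \<and>
           rho \<in> o[at_left tB](\<lambda>t. 1 / (tB - t)\<^sup>2)) \<and>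
        (case2b \<longrightarrow>
           A0 > k * rho0 \<and>
           ((\<lambda>t. (tB - t) * lam 1 t) \<longlongrightarrow> - 1/2 - 1/2 * sqrt (A0 / (A0 - k * rho0))) (at_left tB) \<and>
           (\<forall>i\<in>{3, 4}. ((\<lambda>t. (tB - t) * lam i t) \<longlongrightarrow> - 1/2 + 1/2 * sqrt (A0 / (A0 - k * rho0)))
               (at_left tB)) \<and>
           rho \<in> O[at_left tB](\<lambda>t. 1 / (tB - t)\<^sup>2)) \<and>
        (case3 \<longrightarrow>
           (\<exists>C > 1. ((\<lambda>t. (tB - t) * lam 1 t) \<longlongrightarrow> - C) (at_left tB) \<and>
              (\<forall>i\<in>{J+1..n}. ((\<lambda>t. (tB - t) * lam i t) \<longlongrightarrow> C - 1) (at_left tB)) \<and>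
              rho \<in> O[at_left tB](\<lambda>t. 1 / (tB - t)\<^sup>2))))"
proof -
  have sol: "is_solution n k cb rho0 lam0 tB lam rho"
    and maximal: "\<not> (\<exists>T > tB. \<exists>lam' rho'. is_solution n k cb rho0 lam0 T lam' rho')"
    using maxsol unfolding maximal_solution_def by blast+
  interpret B: riccati_blowup n k cb rho0 tB lam0 lam rho J p q
    by unfold_locales
       (fact n2 kpos cbpos rho0pos tB sol J init_eq init_gap init_mono maximal lim_p lim_q q_nonneg pq)+
  have xi: "xi1 = B.xi1" "xin = B.xin" by (simp_all add: xi1_def xin_def B.xi1_def B.xin_def)
  let ?Rs = "\<lambda>s. \<Sum>i\<in>{1..n}. B.R i s"
  let ?A = "(lam0 1 - lam0 3) * (lam0 1 - lam0 4)"
  have lam_1: "((\<lambda>t. (tB - t) * lam 1 t) \<longlongrightarrow> - 1 - xin) (at_left tB)"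
    using B.lam_1_asymp unfolding xi B.xi_simps(1) .
  have lam_i: "((\<lambda>t. (tB - t) * lam i t) \<longlongrightarrow> xin) (at_left tB)" if "i \<in> {J<..n}" for i
    using B.lam_asymp[OF that] unfolding xi .
  have gam: "(- p * real J + q * (real n - real J)) / (p - q) = B.gam"
    using pq by (simp add: B.gam_def B.xi1_def B.xin_def divide_simps mult.commute)
  have cases: "(J = 1 \<and> (\<forall>\<xi>\<in>{xi1, xin}. \<xi>\<^sup>2 + \<xi> = 0)) \<or>
     (J = 2 \<and> filterlim (\<lambda>t. integral {0..t} ?Rs) at_top (at_left tB)
        \<and> (\<forall>\<xi>\<in>{xi1, xin}. \<xi>\<^sup>2 + \<xi> = 0)) \<or>
     (J = 2 \<and> n = 4 \<and> (\<exists>R0 > 0. ((\<lambda>t. exp (- integral {0..t} ?Rs)) \<longlongrightarrow> R0) (at_left tB) \<and>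
        (\<forall>\<xi>\<in>{xi1, xin}. \<xi>\<^sup>2 + \<xi> - k * rho0 * tB\<^sup>2 * R0 / 4 = 0))) \<or>
     (J \<ge> 3 \<and> n > 2 * J \<and> (\<exists>R0 > 0. ((\<lambda>t. exp (- integral {0..t} ?Rs)) \<longlongrightarrow> R0) (at_left tB) \<and>
        (\<forall>\<xi>\<in>{xi1, xin}. \<xi>\<^sup>2 + \<xi> - k * rho0 * tB\<^sup>2 * R0 / real n = 0)))"
    using B.classification
  proof (elim disjE conjE)
    assume "J = 1" "B.xin = 0"
    then show ?thesis unfolding xi B.xi_roots_0 by blast
  next
    assume "J = 2" "B.xin = 0" "B.gam = - 2"
    then show ?thesis using B.integral_R_at_top unfolding xi B.xi_roots_0 by blast
  next
    assume a: "J = 2" "n = 4" "B.xin > 0" "B.gam = - 2"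
    have "real n = 4" using a by simp
    then show ?thesis using B.exp_integral_R_limit[OF a(4,3)] a(1,2) unfolding xi by metis
  next
    assume a: "J \<ge> 3" "n > 2 * J" "B.xin > 0" "B.gam = - 2"
    then show ?thesis using B.exp_integral_R_limit[OF a(4,3)] unfolding xi by blast
  qed
  have case1: "((\<lambda>t. (tB - t) * lam 1 t) \<longlongrightarrow> -1) (at_left tB) \<and>
       (\<forall>i\<in>{2..n}. lam i \<in> O[at_left tB](\<lambda>t. ln (tB - t))) \<and>
       rho \<in> O[at_left tB](\<lambda>t. 1 / (tB - t))"
    if "J = 1" "\<forall>\<xi>\<in>{xi1, xin}. \<xi>\<^sup>2 + \<xi> = 0"
  proof -
    have "xin = 0" using that(2) unfolding xi B.xi_roots_0 .
    then show ?thesis using lam_1 B.rho_bigo_inverse[OF that(1)] B.lam_bigo_ln[OF that(1)] by simp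
  qed
  have case2a: "n \<ge> 5 \<and> ((\<lambda>t. (tB - t) * lam 1 t) \<longlongrightarrow> -1) (at_left tB) \<and>
       (\<forall>i\<in>{3..n}. ((\<lambda>t. (tB - t) * lam i t) \<longlongrightarrow> 0) (at_left tB) \<and>
           filterlim (\<lambda>t. integral {0..t} (lam i)) at_top (at_left tB)) \<and>
       rho \<in> o[at_left tB](\<lambda>t. 1 / (tB - t)\<^sup>2)"
    if "J = 2" "\<forall>\<xi>\<in>{xi1, xin}. \<xi>\<^sup>2 + \<xi> = 0"
  proof -
    have x: "B.xin = 0" using that(2) unfolding xi B.xi_roots_0 .
    have "filterlim (\<lambda>t. integral {0..t} (lam i)) at_top (at_left tB)" if "i \<in> {3..n}" for i
      using B.I_at_top[OF \<open>J = 2\<close> x that] by (simp add: B.I_def[abs_def])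
    moreover have "((\<lambda>t. (tB - t) * lam i t) \<longlongrightarrow> 0) (at_left tB)" if "i \<in> {3..n}" for i
      using lam_i[of i] that \<open>J = 2\<close> x xi by simp
    ultimately show ?thesis
      using lam_1 x xi B.n_ge_5[OF that(1) x] B.rho_smallo[OF x] by simp
  qed
  have case2b: "?A > k * rho0 \<and>
       ((\<lambda>t. (tB - t) * lam 1 t) \<longlongrightarrow> - 1/2 - 1/2 * sqrt (?A / (?A - k * rho0))) (at_left tB) \<and>
       (\<forall>i\<in>{3, 4}. ((\<lambda>t. (tB - t) * lam i t) \<longlongrightarrow> - 1/2 + 1/2 * sqrt (?A / (?A - k * rho0)))
           (at_left tB)) \<and>
       rho \<in> O[at_left tB](\<lambda>t. 1 / (tB - t)\<^sup>2)"
    if "J = 2" "n = 4"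
  proof -
    \<comment> \<open>The square root equals \<open>1 + 2 * xin\<close>, so the two expressions are
      the leading coefficients already found.\<close>
    have "- 1/2 - 1/2 * sqrt (?A / (?A - k * rho0)) = - 1 - xin"
      "- 1/2 + 1/2 * sqrt (?A / (?A - k * rho0)) = xin"
      unfolding B.sqrt_A[OF that] xi by (simp_all add: field_simps)
    moreover have "i \<in> {J<..n}" if "i \<in> {3, 4}" for i using that \<open>J = 2\<close> \<open>n = 4\<close> by auto
    ultimately show ?thesis
      using lam_1 lam_i B.A_gt[OF that] B.rho_bigo by presburger
  qed
  have case3: "\<exists>C > 1. ((\<lambda>t. (tB - t) * lam 1 t) \<longlongrightarrow> - C) (at_left tB) \<and>
          (\<forall>i\<in>{J+1..n}. ((\<lambda>t. (tB - t) * lam i t) \<longlongrightarrow> C - 1) (at_left tB)) \<and>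
          rho \<in> O[at_left tB](\<lambda>t. 1 / (tB - t)\<^sup>2)"
    if "J \<ge> 3"
  \<comment> \<open>The witness is \<open>- xi1\<close>; it exceeds 1 because
    \<open>J \<ge> 3\<close> occurs only with \<open>xin > 0\<close>.\<close>
  proof (intro exI[of _ "1 + xin"] conjI ballI)
    show "1 + xin > 1" using B.classification that xi by auto
    show "((\<lambda>t. (tB - t) * lam 1 t) \<longlongrightarrow> - (1 + xin)) (at_left tB)" using lam_1 by simp
    show "rho \<in> O[at_left tB](\<lambda>t. 1 / (tB - t)\<^sup>2)" by (rule B.rho_bigo)
    fix i assume "i \<in> {J + 1..n}"
    then show "((\<lambda>t. (tB - t) * lam i t) \<longlongrightarrow> 1 + xin - 1) (at_left tB)" using lam_i[of i] by simp
  qed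
  show ?thesis
    unfolding Let_def
  \<comment> \<open>\<open>B.R\<close> is defined by subtracting the leading terms, so the
    decompositions are immediate; the analytic content is the limit in
    \<open>B.R_tendsto\<close>.\<close>
  proof (rule exI[of _ B.R], intro conjI ballI)
    show "((\<lambda>t. (tB - t) * B.R i t) \<longlongrightarrow> 0) (at_left tB)" if "i \<in> {1..n}" for i
      by (rule B.R_tendsto[OF that])
    show "B.R i t = B.R 1 t" if "i \<in> {1..J}" "t \<in> {0..<tB}" for i t
      using that J B.lam_eq_lam_1[OF that] by (simp add: B.R_def)
    show "lam i t = xi1 / (tB - t) + B.R i t" if "i \<in> {1..J}" for i t
      using that by (simp add: B.R_def xi)
    show "lam i t = xin / (tB - t) + B.R i t" if "i \<in> {J<..n}" for i t
      using that by (simp add: B.R_def xi)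
    show "(\<Sum>i\<in>{1..n}. lam i t) = (- p * real J + q * (real n - real J)) / (p - q) / (tB - t)
        + (\<Sum>i\<in>{1..n}. B.R i t)" for t
      unfolding gam B.sum_R by simp
  qed (use cases case1 case2a case2b case3 in \<open>blast+\<close>)
qed

end
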